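(* Fix $0<\gamma<\tfrac12$ and let $G=(V,E)$ be a $(p,r)$-pseudorandom directed graph on $n$ vertices, where $p\ge \frac{C}{n}$ for some sufficiently large constant $C$, $r\le \mu\sqrt{np}$, $\mu=\mu(\gamma)>0$ is a sufficiently small constant that depends only on $\gamma$, and $n$ is sufficiently large. Let $G'$ be any subgraph of $G$ with at least $(\tfrac12+\gamma)|E|$ edges. Then $G'$ contains a directed cycle of length at least $(1-\alpha-o(1))\cdot n$, where $\alpha$ satisfies $$2\gamma = 1-(1-w(\alpha))(\alpha+w(\alpha)).$$
   Context: For $0\le\alpha<1$, $w(\alpha)=1-(1-\alpha)\lfloor (1-\alpha)^{-1}\rfloor$. In directed graphs, antiparallel edges (both $xy$ and $yx$) are allowed. A directed graph $G=(V,E)$ on $n$ vertices has edge density $p$ if $|E|=pn^2$. For disjoint $A,B\subseteq V$, $e_G(A,B)$ denotes the number of edges of $G$ directed from $A$ to $B$. $G$ is $(p,r)$-pseudorandom if it has edge density $p$ and for every two disjoint sets $A,B\subseteq V$ with $|A|=|B|$, $$\bigl|e_G(A,B)-p|A||B|\bigr|\le r|A|\sqrt{pn}.$$ Directed cycles are simple.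
   Formalization: The constants μ and C may depend on the accuracy ε wanted in the o(1), not on γ alone; with μ fixed by γ and o(1)→0 only as n→∞ the claim fails (complete digraph plus δn isolated vertices, δ much smaller than μ). *)

theory Defs
  imports Complex_Main "Graph_Theory.Graph_Theory"
begin

text \<open>
  The graphs are those of the locale \<^locale>\<open>digraph\<close>: finite, without loops and without parallel
  arcs; arcs \<open>xy\<close> and \<open>yx\<close> may both be present. Cycles are \<^const>\<open>pre_digraph.cycle\<close>, given by
  their list of arcs, with no repeated vertex; the length of the list is the length of the cycle.

  The \<open>o(1)\<close> in ``a cycle of length at least \<open>(1 - \<alpha> - o(1)) n\<close>'' is a term that is smaller than
  any given \<open>\<epsilon> > 0\<close> once the constants \<open>\<mu>\<close> (small), \<open>C\<close> and \<open>n\<close> (large) are chosen accordingly.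
  For fixed \<open>\<mu>\<close> and \<open>C\<close> the loss does not vanish as \<open>n\<close> grows: a complete digraph together with
  \<open>\<delta>n\<close> isolated vertices, \<open>\<delta>\<close> small compared with \<open>\<mu>\<close>, satisfies the pseudorandomness condition with
  \<open>r = \<mu> \<surd>(np)\<close>, and its isolated vertices lie on no cycle.
\<close>

definition w :: "real \<Rightarrow> real" where
  "w \<alpha> = 1 - (1 - \<alpha>) * of_int \<lfloor>inverse (1 - \<alpha>)\<rfloor>"

definition e_between :: "('a, 'b) pre_digraph \<Rightarrow> 'a set \<Rightarrow> 'a set \<Rightarrow> nat" where
  "e_between G A B = card {e \<in> arcs G. tail G e \<in> A \<and> head G e \<in> B}"

definition has_edge_density :: "('a, 'b) pre_digraph \<Rightarrow> real \<Rightarrow> bool" where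
  "has_edge_density G p \<longleftrightarrow> real (card (arcs G)) = p * (real (card (verts G)))\<^sup>2"

definition pseudorandom :: "('a, 'b) pre_digraph \<Rightarrow> real \<Rightarrow> real \<Rightarrow> bool" where
  "pseudorandom G p r \<longleftrightarrow>
     has_edge_density G p \<and>
     (\<forall>A B. A \<subseteq> verts G \<and> B \<subseteq> verts G \<and> A \<inter> B = {} \<and> card A = card B \<longrightarrow>
        \<bar>real (e_between G A B) - p * real (card A) * real (card B)\<bar>
          \<le> r * real (card A) * sqrt (p * real (card (verts G))))"

end

theory Submission
  imports Defs
begin

text \<open>
  A digraph on \<open>n\<close> vertices without cycles longer than \<open>l\<close> has at most \<open>n\<^sup>2/2 + \<Sum> x\<^sub>i\<^sup>2/2\<close> edges up to
  lower order, where \<open>n = \<Sum> x\<^sub>i\<close> is cut into as many parts \<open>x\<^sub>i = l\<close> as possible and a remainder; for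
  \<open>l = (1 - \<alpha>) n\<close> this is \<open>(1/2 + \<gamma>) n\<^sup>2\<close>, and it is strictly smaller for smaller \<open>l\<close>. To transfer this
  to the sparse setting, almost all vertices are split into boundedly many clusters of equal size such
  that few pairs of clusters are joined by an edge of \<open>G'\<close> and at the same time have a hole, that is, two
  large subsets without an edge of \<open>G'\<close> from the first to the second. Instead of the energy increment of
  a regularity lemma it is enough to follow the measure of the set of joined pairs, which drops
  whenever many holes are cut out. By pseudorandomness the remaining joined pairs form a reduced digraph
  of density at least \<open>1/2 + \<gamma>\<close> up to a small error, hence with a cycle through almost \<open>1 - \<alpha>\<close> of all
  clusters. Depth-first search along this cycle of clusters finds a path through almost all of their
  vertices, which can be closed because there are no holes.
\<close>

subsection \<open>Digraphs without long cycles\<close>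

text \<open>
  The sum of the squares of the parts when \<open>n\<close> is cut into parts of size \<open>l\<close> and one smaller remainder.
  For \<open>n = 1\<close> and \<open>l = 1 - \<alpha>\<close> the remainder is \<open>w(\<alpha>)\<close> and the value is \<open>1 - (1 - w(\<alpha>)) (\<alpha> + w(\<alpha>))\<close>.
\<close>

definition packed_squares :: "real \<Rightarrow> real \<Rightarrow> real" where
  "packed_squares n l = of_int \<lfloor>n / l\<rfloor> * l\<^sup>2 + (n - of_int \<lfloor>n / l\<rfloor> * l)\<^sup>2"

text \<open>Models the removal of a cycle of length \<open>x\<close>. With \<open>s\<close> the
  remainder, the right side exceeds the left by \<open>2 * x * (s - x)\<close> if
  \<open>x \<le> s\<close>; otherwise the quotient drops by one and the excess is
  \<open>2 * (x - s) * (l - x)\<close>.\<close>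

lemma packed_squares_step:
  assumes "0 < l" "0 \<le> x" "x \<le> l"
  shows "x\<^sup>2 + packed_squares (n - x) l \<le> packed_squares n l"
proof -
  define q where "q = \<lfloor>n / l\<rfloor>"
  define s where "s = n - of_int q * l"
  have "of_int q \<le> n / l" "n / l < of_int q + 1"
    unfolding q_def by linarith+
  hence s: "0 \<le> s" "s < l"
    using assms(1) by (auto simp: s_def field_simps)
  have n: "packed_squares n l = of_int q * l\<^sup>2 + s\<^sup>2"
    by (simp add: packed_squares_def q_def s_def)
  show ?thesis
  proof (cases "x \<le> s")
    case True
    have "\<lfloor>(n - x) / l\<rfloor> = q"
      using assms s True by (intro floor_unique) (auto simp: s_def field_simps)
    hence "packed_squares (n - x) l = of_int q * l\<^sup>2 + (s - x)\<^sup>2"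
      by (simp add: packed_squares_def s_def algebra_simps)
    moreover have "0 \<le> x * (s - x)" using True assms by simp
    ultimately show ?thesis
      unfolding n by (simp add: power2_eq_square algebra_simps)
  next
    case False
    have "\<lfloor>(n - x) / l\<rfloor> = q - 1"
      using assms s False by (intro floor_unique) (auto simp: s_def field_simps)
    moreover have "n - x - of_int (q - 1) * l = s + l - x"
      by (simp add: s_def algebra_simps)
    ultimately have "packed_squares (n - x) l = of_int (q - 1) * l\<^sup>2 + (s + l - x)\<^sup>2"
      unfolding packed_squares_def by metis
    moreover have "0 \<le> (x - s) * (l - x)" using False assms by simp
    ultimately show ?thesis
      unfolding n by (simp add: power2_eq_square algebra_simps)
  qed
qed

lemma packed_squares_scale:
  assumes "0 < c"
  shows "packed_squares (c * n) (c * l) = c\<^sup>2 * packed_squares n l"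
  using assms by (simp add: packed_squares_def power2_eq_square algebra_simps)

text \<open>Supplies the slack that later absorbs all error terms. As long as
  \<open>l' > 1 / (q + 1)\<close>, decreasing \<open>l\<close> does not change the quotient
  \<open>q\<close>, and there the polynomial \<open>1 + q * ((q + 1) * l\<^sup>2 - 2 * l)\<close> is
  strictly increasing in \<open>l\<close>.\<close>

lemma packed_squares_less:
  assumes "0 < l" "l \<le> 1" "0 < \<epsilon>"
  obtains l' where "0 < l'" "l - \<epsilon> < l'" "l' < l" "packed_squares 1 l' < packed_squares 1 l"
proof -
  define q where "q = \<lfloor>1 / l\<rfloor>"
  have q: "of_int q \<le> 1 / l" "1 / l < of_int q + 1"
    unfolding q_def by linarith+
  have "1 \<le> 1 / l" using assms by (simp add: field_simps)
  hence "1 \<le> q" unfolding q_def by simp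
  have *: "of_int q * l \<le> 1" "1 / (of_int q + 1) < l"
    using q assms \<open>1 \<le> q\<close> by (auto simp: field_simps)
  obtain l' where l': "max (l - \<epsilon>) (1 / (of_int q + 1)) < l'" "l' < l"
    using dense[of "max (l - \<epsilon>) (1 / (of_int q + 1))" l] * assms by auto
  have pos: "0 < l'"
    using l' \<open>1 \<le> q\<close> by (smt (verit) divide_pos_pos of_int_pos)
  have less: "1 < (of_int q + 1) * l'"
    using l' \<open>1 \<le> q\<close> by (simp add: field_simps)
  have "of_int q * l' \<le> of_int q * l"
    using l' \<open>1 \<le> q\<close> by (intro mult_left_mono) auto
  hence "\<lfloor>1 / l'\<rfloor> = q"
    using pos less * by (intro floor_unique) (auto simp: field_simps)
  moreover have "0 < of_int q * (l - l') * ((of_int q + 1) * l - 1 + ((of_int q + 1) * l' - 1))"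
  proof (intro mult_pos_pos add_pos_pos)
    show "0 < (of_int q + 1) * l - 1"
      using * \<open>1 \<le> q\<close> by (simp add: field_simps)
  qed (use less l' \<open>1 \<le> q\<close> in auto)
  ultimately have "packed_squares 1 l' < packed_squares 1 l"
    by (simp add: packed_squares_def q_def[symmetric] power2_eq_square algebra_simps)
  thus ?thesis using that pos l' by auto
qed

section \<open>Longest cycles and the number of edges\<close>

text \<open>A single vertex counts as a cycle of length 1, so that every nonempty vertex set has a longest cycle.\<close>

definition cyc :: "('a \<Rightarrow> 'a \<Rightarrow> bool) \<Rightarrow> 'a list \<Rightarrow> bool" where
  "cyc E xs \<longleftrightarrow> xs \<noteq> [] \<and> distinct xs \<and>
     (1 < length xs \<longrightarrow> (\<forall>i<length xs. E (xs ! i) (xs ! (Suc i mod length xs))))"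

text \<open>Rotating by \<open>Suc i\<close> makes \<open>xs ! i\<close> the last entry, so that
  \<open>v\<close> in front comes between \<open>xs ! i\<close> and its successor. If
  \<open>xs\<close> is a single vertex, the result is a pair of antiparallel edges.\<close>

lemma cyc_insert:
  assumes "cyc E xs" "v \<notin> set xs" "i < length xs" "E (xs ! i) v" "E v (xs ! (Suc i mod length xs))"
  shows "cyc E (v # rotate (Suc i) xs)"
proof -
  let ?m = "length xs"
  have m: "0 < ?m" using assms by auto
  have "E ((v # rotate (Suc i) xs) ! j) ((v # rotate (Suc i) xs) ! (Suc j mod Suc ?m))" if "j < Suc ?m" for j
  proof (cases j)
    case 0
    thus ?thesis using assms m by (auto simp: nth_rotate simp del: rotate_Suc)
  next
    case (Suc k)
    hence k: "k < ?m" using that by simp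
    show ?thesis
    proof (cases "Suc k < ?m")
      case True
      have "E (xs ! ((Suc i + k) mod ?m)) (xs ! (Suc ((Suc i + k) mod ?m) mod ?m))"
        using assms(1) True m unfolding cyc_def by auto
      thus ?thesis using True Suc k
        by (simp add: nth_rotate mod_Suc_eq del: rotate_Suc)
    next
      case False
      hence "Suc k = ?m" using k by simp
      hence "(Suc i + k) mod ?m = i" using assms by (metis add_Suc_shift mod_add_self2 mod_less)
      hence "rotate (Suc i) xs ! k = xs ! i" using k by (simp add: nth_rotate del: rotate_Suc)
      thus ?thesis using Suc \<open>Suc k = ?m\<close>[symmetric] assms by (simp del: rotate_Suc)
    qed
  qed
  thus ?thesis using assms by (auto simp: cyc_def simp del: rotate_Suc)
qed

text \<open>If some \<open>xs ! i\<close> had an edge to \<open>v\<close> and its successor an edge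
  from \<open>v\<close>, then \<open>v\<close> could be inserted there. Hence the positions of
  in-neighbours and the positions just before out-neighbours are disjoint subsets of the
  \<open>length xs\<close> positions.\<close>

lemma degree_to_longest_cycle:
  assumes "cyc E xs" "v \<notin> set xs"
    and longest: "\<And>ys. cyc E ys \<Longrightarrow> set ys \<subseteq> insert v (set xs) \<Longrightarrow> length ys \<le> length xs"
  shows "card {x \<in> set xs. E x v} + card {x \<in> set xs. E v x} \<le> length xs"
proof -
  let ?m = "length xs"
  have m: "0 < ?m" and d: "distinct xs" using assms by (auto simp: cyc_def)
  let ?I = "{i. i < ?m \<and> E (xs ! i) v}" and ?J = "{i. i < ?m \<and> E v (xs ! (Suc i mod ?m))}"
  have "{x \<in> set xs. E x v} \<subseteq> (!) xs ` ?I"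
    by (auto simp: in_set_conv_nth)
  hence 1: "card {x \<in> set xs. E x v} \<le> card ?I"
    by (intro surj_card_le) auto
  have "{x \<in> set xs. E v x} \<subseteq> (\<lambda>i. xs ! (Suc i mod ?m)) ` ?J"
  proof clarify
    fix x assume x: "x \<in> set xs" "E v x"
    then obtain i where i: "i < ?m" "xs ! i = x" by (auto simp: in_set_conv_nth)
    \<comment> \<open>The cyclic predecessor of position \<open>i\<close>.\<close>
    define k where "k = (if i = 0 then ?m - 1 else i - 1)"
    have "k < ?m" "Suc k mod ?m = i" using i m by (auto simp: k_def)
    thus "x \<in> (\<lambda>i. xs ! (Suc i mod ?m)) ` ?J"
      using i x by (intro image_eqI[of _ _ k]) auto
  qed
  hence 2: "card {x \<in> set xs. E v x} \<le> card ?J"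
    by (intro surj_card_le) auto
  have "?I \<inter> ?J = {}"
  proof (rule ccontr)
    assume "?I \<inter> ?J \<noteq> {}"
    then obtain i where "i < ?m" "E (xs ! i) v" "E v (xs ! (Suc i mod ?m))" by auto
    from cyc_insert[OF assms(1,2) this] have "cyc E (v # rotate (Suc i) xs)" .
    from longest[OF this] show False by (auto simp del: rotate_Suc)
  qed
  hence "card ?I + card ?J = card (?I \<union> ?J)" by (subst card_Un_disjoint) auto
  also have "\<dots> \<le> card {..<?m}" by (intro card_mono) auto
  finally show ?thesis using 1 2 by simp
qed

lemma card_edges_between:
  assumes "finite A" "finite B"
  shows "card {(x, y). x \<in> A \<and> y \<in> B \<and> E x y} = (\<Sum>y\<in>B. card {x \<in> A. E x y})"
proof -
  have "{(x, y). x \<in> A \<and> y \<in> B \<and> E x y} = (\<lambda>(y, x). (x, y)) ` (SIGMA y:B. {x \<in> A. E x y})"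
    by auto
  moreover have "inj_on (\<lambda>(y, x). (x, y)) (SIGMA y:B. {x \<in> A. E x y})" by (auto intro: inj_onI)
  ultimately show ?thesis using assms by (simp add: card_image)
qed

text \<open>
  Induction on the number of vertices: remove a longest cycle, of length \<open>m\<close>. Every other vertex has at
  most \<open>m\<close> edges to and from it, so that at most \<open>m\<^sup>2 + m (n - m)\<close> edges are lost.
\<close>

lemma edges_le_packed_squares:
  assumes "finite V" and "0 < l"
    and "\<And>xs. cyc E xs \<Longrightarrow> set xs \<subseteq> V \<Longrightarrow> real (length xs) \<le> l"
  shows "real (card {(x, y). x \<in> V \<and> y \<in> V \<and> E x y})
     \<le> ((real (card V))\<^sup>2 + packed_squares (real (card V)) l) / 2"
  using assms(1,3)
proof (induction "card V" arbitrary: V rule: less_induct)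
  case less
  note fin = \<open>finite V\<close>
  show ?case
  proof (cases "V = {}")
    case True
    thus ?thesis by (simp add: packed_squares_def)
  next
    case False
    then obtain v where "v \<in> V" by auto
    hence "cyc E [v] \<and> set [v] \<subseteq> V" by (auto simp: cyc_def)
    moreover have "length xs \<le> card V" if "cyc E xs \<and> set xs \<subseteq> V" for xs
      using that fin by (metis card_mono cyc_def distinct_card)
    ultimately obtain xs where xs: "cyc E xs" "set xs \<subseteq> V"
      and longest: "\<And>ys. cyc E ys \<and> set ys \<subseteq> V \<Longrightarrow> length ys \<le> length xs"
      using ex_has_greatest_nat[of "\<lambda>xs. cyc E xs \<and> set xs \<subseteq> V" "[v]" length "Suc (card V)"] by (auto simp: less_Suc_eq_le)
    define C where "C = set xs"
    define m where "m = card C"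
    have m: "m = length xs" using xs by (simp add: C_def m_def cyc_def distinct_card)
    have "0 < m" using xs m by (auto simp: cyc_def)
    have C: "C \<subseteq> V" "finite C" using xs by (auto simp: C_def)
    define W where "W = V - C"
    have W: "finite W" "W \<subseteq> V" "C \<inter> W = {}" "V = C \<union> W" using fin C by (auto simp: W_def)
    have n: "card V = m + card W" using W C by (simp add: m_def card_Un_disjoint)
    let ?e = "\<lambda>A B. {(x, y). x \<in> A \<and> y \<in> B \<and> E x y}"
    have CC: "card (?e C C) \<le> m * m"
      using card_mono[of "C \<times> C" "?e C C"] C by (auto simp: m_def card_cartesian_product)
    have WC: "card (?e W C) = (\<Sum>v\<in>W. card {x \<in> C. E v x})"
    proof -
      have "?e W C = prod.swap ` {(x, y). x \<in> C \<and> y \<in> W \<and> E y x}" by auto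
      hence "card (?e W C) = card {(x, y). x \<in> C \<and> y \<in> W \<and> E y x}" by (simp add: card_image)
      thus ?thesis using card_edges_between[OF C(2) W(1), of "\<lambda>x y. E y x"] by simp
    qed
    have "card (?e C W) + card (?e W C) = (\<Sum>v\<in>W. card {x \<in> C. E x v} + card {x \<in> C. E v x})"
      using card_edges_between[OF C(2) W(1), of E] WC by (simp add: sum.distrib)
    also have "\<dots> \<le> (\<Sum>v\<in>W. m)"
    proof (rule sum_mono)
      fix v assume v: "v \<in> W"
      show "card {x \<in> C. E x v} + card {x \<in> C. E v x} \<le> m"
        unfolding C_def m using v xs W
        by (intro degree_to_longest_cycle longest) (auto simp: C_def)
    qed
    finally have CW: "card (?e C W) + card (?e W C) \<le> card W * m" by simp
    have IH: "real (card (?e W W)) \<le> ((real (card W))\<^sup>2 + packed_squares (real (card W)) l) / 2"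
      using less.prems(2) W n \<open>0 < m\<close> by (intro less.hyps) auto
    have "?e V V = ?e C C \<union> (?e C W \<union> ?e W C) \<union> ?e W W" using W by auto
    hence "card (?e V V) = card (?e C C \<union> (?e C W \<union> ?e W C) \<union> ?e W W)" by (rule arg_cong)
    also have "\<dots> \<le> card (?e C C) + (card (?e C W) + card (?e W C)) + card (?e W W)"
      by (intro order.trans[OF card_Un_le] add_mono order.refl)
    also have "\<dots> \<le> m * m + card W * m + card (?e W W)" using CC CW by simp
    finally have *: "card (?e V V) \<le> m * m + card W * m + card (?e W W)" .
    define c where "c = real (card (?e V V))"
    define d where "d = real (card (?e W W))"
    \<comment> \<open>With \<open>n = card V\<close>, the loss \<open>m * m + card W * m\<close> is
      half of \<open>n\<^sup>2 - (card W)\<^sup>2 + m\<^sup>2\<close>. The first two terms account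
      for the change of the square, and \<open>packed_squares_step\<close> absorbs the
      third.\<close>
    have "c \<le> real (m * m + card W * m) + d"
      using * unfolding c_def d_def of_nat_add[symmetric] by (rule of_nat_mono)
    moreover have "d \<le> ((real (card W))\<^sup>2 + packed_squares (real (card W)) l) / 2"
      using IH unfolding d_def .
    moreover have "(real m)\<^sup>2 + packed_squares (real (card V) - real m) l \<le> packed_squares (real (card V)) l"
      using less.prems(2)[OF xs] m assms by (intro packed_squares_step) auto
    moreover have "real (card V) - real m = real (card W)" using n by simp
    moreover have "(real (card V))\<^sup>2 = real m * real m + 2 * (real (card W) * real m) + (real (card W))\<^sup>2"
      by (simp add: n power2_eq_square algebra_simps)
    ultimately have "c \<le> ((real (card V))\<^sup>2 + packed_squares (real (card V)) l) / 2"
      by (simp add: power2_eq_square)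
    thus ?thesis unfolding c_def .
  qed
qed

subsection \<open>Clusters with few holes\<close>

definition linked :: "('a \<Rightarrow> 'a \<Rightarrow> bool) \<Rightarrow> 'a set \<Rightarrow> 'a set \<Rightarrow> bool" where
  "linked E X Y \<longleftrightarrow> (\<exists>x\<in>X. \<exists>y\<in>Y. E x y)"

definition hole :: "('a \<Rightarrow> 'a \<Rightarrow> bool) \<Rightarrow> real \<Rightarrow> 'a set \<Rightarrow> 'a set \<Rightarrow> bool" where
  "hole E k X Y \<longleftrightarrow> (\<exists>A B. A \<subseteq> X \<and> B \<subseteq> Y \<and> k \<le> real (card A) \<and> k \<le> real (card B) \<and> \<not> linked E A B)"

definition clusters :: "'a set \<Rightarrow> nat \<Rightarrow> 'a set set \<Rightarrow> bool" where
  "clusters V N F \<longleftrightarrow> pairwise disjnt F \<and> (\<forall>X\<in>F. X \<subseteq> V \<and> card X = N)"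

text \<open>A set of pairs of vertices instead of a sum over pairs of clusters, so that partitions
  into clusters of different sizes can be compared by inclusion.\<close>

definition linked_part :: "('a \<Rightarrow> 'a \<Rightarrow> bool) \<Rightarrow> 'a set set \<Rightarrow> ('a \<times> 'a) set" where
  "linked_part E F = (\<Union>(X, Y)\<in>{(X, Y). X \<in> F \<and> Y \<in> F \<and> linked E X Y}. X \<times> Y)"

text \<open>Only linked pairs count: an unlinked pair contributes neither to the linked area nor to
  the edges of the reduced digraph.\<close>

definition holes :: "('a \<Rightarrow> 'a \<Rightarrow> bool) \<Rightarrow> real \<Rightarrow> nat \<Rightarrow> 'a set set \<Rightarrow> ('a set \<times> 'a set) set" where
  "holes E \<eta> N F = {(X, Y). X \<in> F \<and> Y \<in> F \<and> linked E X Y \<and> hole E (\<eta> * real N) X Y}"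

text \<open>\<open>K\<close> keeps the clusters small, so that there are many of them;
  \<open>M\<close> keeps them of linear size, so that their number is bounded;
  \<open>\<theta>\<close> is the proportion of vertices that may remain uncovered.\<close>

definition balanced :: "'a set \<Rightarrow> nat \<Rightarrow> nat \<Rightarrow> real \<Rightarrow> nat \<Rightarrow> 'a set set \<Rightarrow> bool" where
  "balanced V K M \<theta> N F \<longleftrightarrow> clusters V N F \<and> N * K \<le> card V \<and> card V \<le> M * N \<and>
    (1 - \<theta>) * real (card V) \<le> real (card (\<Union>F))"

lemma clusters_finite: "clusters V N F \<Longrightarrow> finite V \<Longrightarrow> finite F"
  unfolding clusters_def by (meson PowI finite_Pow_iff finite_subset subsetI)

lemma clusters_Union: "clusters V N F \<Longrightarrow> \<Union>F \<subseteq> V"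
  unfolding clusters_def by blast

lemma card_Union_clusters:
  assumes "clusters V N F" "finite V"
  shows "card (\<Union>F) = card F * N"
proof -
  have "card (\<Union>F) = sum card F"
    using assms by (intro card_Union_disjoint) (auto simp: clusters_def intro: finite_subset)
  also have "\<dots> = (\<Sum>X\<in>F. N)" using assms by (intro sum.cong) (auto simp: clusters_def)
  finally show ?thesis by simp
qed

lemma clusters_Un:
  assumes "clusters V N F" "clusters W N F'" "V \<inter> W = {}"
  shows "clusters (V \<union> W) N (F \<union> F')"
proof -
  have disj: "disjnt X Y" if "X \<in> F" "Y \<in> F'" for X Y
    using that assms unfolding clusters_def disjnt_def by fast
  have "disjnt X Y" if "X \<in> F \<union> F'" "Y \<in> F \<union> F'" "X \<noteq> Y" for X Y
    using that assms(1,2) disj[of X Y] disj[of Y X]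
    unfolding clusters_def by (auto dest: pairwiseD simp: disjnt_sym)
  thus ?thesis using assms(1,2) unfolding clusters_def by (auto intro!: pairwiseI)
qed

section \<open>Cutting a vertex set into clusters of equal size\<close>

lemma clusters_chop:
  assumes "finite W" "0 < N"
  shows "\<exists>F. clusters W N F \<and> card W \<le> card (\<Union>F) + N"
  using assms(1)
proof (induction "card W" arbitrary: W rule: less_induct)
  case less
  show ?case
  proof (cases "card W < N")
    case True
    thus ?thesis by (intro exI[of _ "{}"]) (auto simp: clusters_def)
  next
    case False
    then obtain X where X: "X \<subseteq> W" "card X = N"
      by (metis not_less obtain_subset_with_card_n)
    have "card (W - X) = card W - N"
      using X less.prems by (simp add: card_Diff_subset finite_subset)
    moreover have "card W - N < card W" using False assms(2) by simp
    ultimately obtain F where F: "clusters (W - X) N F" "card (W - X) \<le> card (\<Union>F) + N"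
      using less.hyps[of "W - X"] less.prems by auto
    have "clusters X N {X}" using X by (simp add: clusters_def)
    hence cl: "clusters (X \<union> (W - X)) N ({X} \<union> F)"
      by (rule clusters_Un) (use F in auto)
    have "X \<inter> \<Union>F = {}" using clusters_Union[OF F(1)] by auto
    hence "card (\<Union>({X} \<union> F)) = N + card (\<Union>F)"
      using X less.prems clusters_Union[OF F(1)]
      by (simp add: card_Un_disjoint finite_subset)
    moreover have "X \<union> (W - X) = W" using X by auto
    ultimately show ?thesis
      using cl F \<open>card (W - X) = card W - N\<close> False by (intro exI[of _ "{X} \<union> F"]) auto
  qed
qed

text \<open>The sets in \<open>D\<close> cut \<open>W\<close> into at most \<open>2 ^ card D\<close>
  atoms, and chopping an atom into clusters leaves at most \<open>N\<close> of its vertices over.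
  The induction splits \<open>W\<close> along one set at a time.\<close>

lemma clusters_separate:
  assumes "finite D" "finite W" "0 < N"
  shows "\<exists>F. clusters W N F \<and> (\<forall>X\<in>F. \<forall>T\<in>D. X \<subseteq> T \<or> X \<inter> T = {}) \<and>
    card W \<le> card (\<Union>F) + 2 ^ card D * N"
  using assms(1,2)
proof (induction D arbitrary: W rule: finite_induct)
  case empty
  thus ?case using clusters_chop[OF _ assms(3)] by simp
next
  case (insert T D)
  obtain F where F: "clusters (W \<inter> T) N F" "\<forall>X\<in>F. \<forall>T\<in>D. X \<subseteq> T \<or> X \<inter> T = {}"
      "card (W \<inter> T) \<le> card (\<Union>F) + 2 ^ card D * N"
    using insert.IH[of "W \<inter> T"] insert.prems by auto
  obtain F' where F': "clusters (W - T) N F'" "\<forall>X\<in>F'. \<forall>T\<in>D. X \<subseteq> T \<or> X \<inter> T = {}"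
      "card (W - T) \<le> card (\<Union>F') + 2 ^ card D * N"
    using insert.IH[of "W - T"] insert.prems by auto
  have sub: "\<Union>F \<subseteq> W \<inter> T" "\<Union>F' \<subseteq> W - T"
    using clusters_Union F(1) F'(1) by blast+
  have W: "W = (W \<inter> T) \<union> (W - T)" by auto
  have "clusters W N (F \<union> F')"
    using clusters_Un[OF F(1) F'(1)] W by auto
  moreover have "\<forall>X\<in>F \<union> F'. \<forall>T\<in>insert T D. X \<subseteq> T \<or> X \<inter> T = {}"
  proof (intro ballI)
    fix X S assume X: "X \<in> F \<union> F'" and S: "S \<in> insert T D"
    from X consider "X \<in> F" | "X \<in> F'" by blast
    thus "X \<subseteq> S \<or> X \<inter> S = {}"
    proof cases
      case 1
      hence "X \<subseteq> T" using sub by auto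
      thus ?thesis using F(2) 1 S by auto
    next
      case 2
      hence "X \<inter> T = {}" using sub by auto
      thus ?thesis using F'(2) 2 S by auto
    qed
  qed
  moreover have "card W = card (W \<inter> T) + card (W - T)"
    using insert.prems by (subst W, subst card_Un_disjoint) auto
  moreover have "card (\<Union>(F \<union> F')) = card (\<Union>F) + card (\<Union>F')"
    using sub insert.prems
    by (simp, intro card_Un_disjoint) (auto intro: finite_subset[of _ W])
  ultimately show ?case
    using F(3) F'(3) insert.hyps by (intro exI[of _ "F \<union> F'"]) (simp add: algebra_simps)
qed

lemma linked_part_subset: "clusters V N F \<Longrightarrow> linked_part E F \<subseteq> V \<times> V"
  unfolding linked_part_def clusters_def by blast

section \<open>Refinement and the decrease of the linked area\<close>

text \<open>
  The potential is the area of the linked pairs. No edge runs between the two sides of a hole, so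
  refining all clusters along the sides of all holes removes the area of these holes from it.
\<close>

lemma clusters_refine:
  assumes cl: "clusters V N F" and fin: "finite V" and "0 < N'" and "0 \<le> k"
    and H: "H = {(X, Y). X \<in> F \<and> Y \<in> F \<and> linked E X Y \<and> hole E k X Y}"
  shows "\<exists>F'. clusters V N' F' \<and> card (\<Union>F) \<le> card (\<Union>F') + 2 ^ (card F + 2 * (card F)\<^sup>2) * N' \<and>
    real (card (linked_part E F')) + real (card H) * k\<^sup>2 \<le> real (card (linked_part E F))"
proof -
  have fF: "finite F" using cl fin by (rule clusters_finite)
  have HF: "H \<subseteq> F \<times> F" unfolding H by auto
  hence fH: "finite H" using fF by (auto intro: finite_subset)
  have "\<forall>p\<in>H. \<exists>A B. A \<subseteq> fst p \<and> B \<subseteq> snd p \<and> k \<le> real (card A) \<and> k \<le> real (card B) \<and> \<not> linked E A B"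
    unfolding H hole_def by auto
  then obtain a b where ab: "\<And>p. p \<in> H \<Longrightarrow> a p \<subseteq> fst p \<and> b p \<subseteq> snd p \<and>
      k \<le> real (card (a p)) \<and> k \<le> real (card (b p)) \<and> \<not> linked E (a p) (b p)"
    by metis
  \<comment> \<open>With \<open>F\<close> in \<open>D\<close>, each new cluster lies in a single old
    one; with the sides of the chosen holes in \<open>D\<close>, it lies inside or outside each
    side. One hole per pair gives at most \<open>2 * (card F)\<^sup>2\<close> sides.\<close>
  define D where "D = F \<union> (a ` H \<union> b ` H)"
  have fD: "finite D" using fF fH by (simp add: D_def)
  have "card H \<le> (card F)\<^sup>2"
    using card_mono[OF _ HF] fF by (simp add: card_cartesian_product power2_eq_square)
  hence cD: "card D \<le> card F + 2 * (card F)\<^sup>2"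
    unfolding D_def using card_Un_le[of F "a ` H \<union> b ` H"] card_Un_le[of "a ` H" "b ` H"]
      card_image_le[OF fH, of a] card_image_le[OF fH, of b] by linarith
  have sub: "\<Union>F \<subseteq> V" by (rule clusters_Union[OF cl])
  hence fU: "finite (\<Union>F)" using fin by (rule finite_subset)
  obtain F' where "clusters (\<Union>F) N' F' \<and> (\<forall>X\<in>F'. \<forall>T\<in>D. X \<subseteq> T \<or> X \<inter> T = {}) \<and>
      card (\<Union>F) \<le> card (\<Union>F') + 2 ^ card D * N'"
    using clusters_separate[OF fD fU \<open>0 < N'\<close>] by (rule exE)
  hence F': "clusters (\<Union>F) N' F'" "\<And>X T. X \<in> F' \<Longrightarrow> T \<in> D \<Longrightarrow> X \<subseteq> T \<or> X \<inter> T = {}"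
      "card (\<Union>F) \<le> card (\<Union>F') + 2 ^ card D * N'"
    by simp_all
  have cl': "clusters V N' F'" using F'(1) sub unfolding clusters_def by fast
  \<comment> \<open>The area cut out by the holes. The rectangles are disjoint because they lie in
    different products of disjoint clusters, so each of them contributes its full area, at least
    \<open>k\<^sup>2\<close>.\<close>
  define R where "R = (\<Union>p\<in>H. a p \<times> b p)"
  have fR: "finite (a p \<times> b p)" if "p \<in> H" for p
  proof -
    have "fst p \<in> F" "snd p \<in> F" using that HF by auto
    hence "a p \<subseteq> V" "b p \<subseteq> V" using ab[OF that] sub by auto
    thus ?thesis using fin by (auto intro: finite_subset)
  qed
  have "card R = (\<Sum>p\<in>H. card (a p \<times> b p))"
    unfolding R_def
  proof (rule card_UN_disjoint[OF fH])
    show "\<forall>p\<in>H. finite (a p \<times> b p)" using fR by blast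
    show "\<forall>p\<in>H. \<forall>q\<in>H. p \<noteq> q \<longrightarrow> (a p \<times> b p) \<inter> (a q \<times> b q) = {}"
    proof (intro ballI impI)
      fix p q assume pq: "p \<in> H" "q \<in> H" "p \<noteq> q"
      hence "fst p \<noteq> fst q \<or> snd p \<noteq> snd q" by (simp add: prod_eq_iff)
      moreover have "fst p \<in> F" "fst q \<in> F" "snd p \<in> F" "snd q \<in> F" using pq HF by auto
      ultimately have "fst p \<inter> fst q = {} \<or> snd p \<inter> snd q = {}"
        using cl unfolding clusters_def pairwise_def disjnt_def by metis
      thus "(a p \<times> b p) \<inter> (a q \<times> b q) = {}" using ab pq by blast
    qed
  qed
  hence "real (card R) = (\<Sum>p\<in>H. real (card (a p)) * real (card (b p)))"
    by (simp add: card_cartesian_product)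
  moreover have "(\<Sum>p\<in>H. k * k) \<le> (\<Sum>p\<in>H. real (card (a p)) * real (card (b p)))"
    using ab assms(4) by (intro sum_mono mult_mono) auto
  ultimately have cR: "real (card H) * k\<^sup>2 \<le> real (card R)" by (simp add: power2_eq_square)
  have RF: "R \<subseteq> linked_part E F"
  proof
    fix z assume "z \<in> R"
    then obtain p where "p \<in> H" "z \<in> a p \<times> b p" unfolding R_def by blast
    moreover from this have "z \<in> fst p \<times> snd p" using ab by blast
    ultimately show "z \<in> linked_part E F" unfolding linked_part_def H by fastforce
  qed
  \<comment> \<open>A linked pair of new clusters lies in a linked pair of old ones. If it met
    \<open>a p \<times> b p\<close>, it would be contained in it, although no edge runs from
    \<open>a p\<close> to \<open>b p\<close>.\<close>
  have "linked_part E F' \<subseteq> linked_part E F - R"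
  proof
    fix z assume "z \<in> linked_part E F'"
    then obtain X' Y' where X': "X' \<in> F'" "Y' \<in> F'" "linked E X' Y'" "z \<in> X' \<times> Y'"
      unfolding linked_part_def by blast
    obtain x y where z: "z = (x, y)" "x \<in> X'" "y \<in> Y'" using X' by blast
    have "X' \<subseteq> \<Union>F" "Y' \<subseteq> \<Union>F" using clusters_Union[OF F'(1)] X' by auto
    then obtain X Y where X: "X \<in> F" "Y \<in> F" "x \<in> X" "y \<in> Y" using z by blast
    have "X' \<subseteq> X" "Y' \<subseteq> Y" using F'(2)[of X' X] F'(2)[of Y' Y] X X' z by (auto simp: D_def)
    hence "linked E X Y" using X'(3) unfolding linked_def by blast
    hence "z \<in> linked_part E F" using X z unfolding linked_part_def by blast
    moreover have "z \<notin> R"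
    proof
      assume "z \<in> R"
      then obtain p where p: "p \<in> H" "x \<in> a p" "y \<in> b p" unfolding R_def using z by blast
      hence "X' \<subseteq> a p" "Y' \<subseteq> b p"
        using F'(2)[of X' "a p"] F'(2)[of Y' "b p"] X' z by (auto simp: D_def)
      thus False using X'(3) ab[OF p(1)] unfolding linked_def by blast
    qed
    ultimately show "z \<in> linked_part E F - R" by simp
  qed
  moreover have fl: "finite (linked_part E F)"
    using linked_part_subset[OF cl, of E] fin by (auto intro: finite_subset)
  ultimately have "card (linked_part E F') \<le> card (linked_part E F - R)"
    by (intro card_mono) auto
  also have "\<dots> = card (linked_part E F) - card R"
    using RF fl by (simp add: card_Diff_subset finite_subset)
  finally have "card (linked_part E F') + card R \<le> card (linked_part E F)"
    using card_mono[OF fl RF] by simp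
  hence "real (card (linked_part E F')) + real (card R) \<le> real (card (linked_part E F))"
    by (metis of_nat_add of_nat_mono)
  moreover have "card (\<Union>F) \<le> card (\<Union>F') + 2 ^ (card F + 2 * (card F)\<^sup>2) * N'"
    using F'(3) power_increasing[OF cD, of "2::nat"]
    by (meson add_left_mono le_trans mult_le_mono1 one_le_numeral)
  ultimately show ?thesis using cl' cR by (intro exI[of _ F']) auto
qed

text \<open>As long as holes abound, each of the \<open>s\<close> refinements lowers the linked area
  by a fixed proportion. The loss \<open>\<theta>\<close> varies in the induction: half of it goes
  to the earlier rounds and half to the last one. The bounds \<open>M\<close> and
  \<open>n\<^sub>0\<close> do not depend on \<open>E\<close>.\<close>

lemma clusters_iterate:
  fixes \<eta> \<epsilon> \<theta> :: real and K\<^sub>0 s :: nat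
  assumes "0 < \<eta>" "0 < \<epsilon>" "0 < K\<^sub>0" "0 < \<theta>" "\<theta> \<le> 1/2"
  shows "\<exists>M>0. \<exists>n\<^sub>0. \<forall>(V :: 'a set) E. finite V \<and> n\<^sub>0 \<le> card V \<longrightarrow>
    (\<exists>N F. balanced V K\<^sub>0 M \<theta> N F \<and>
      (real (card (holes E \<eta> N F)) \<le> \<epsilon> * (real (card F))\<^sup>2
       \<or> real (card (linked_part E F)) \<le> (1 - real s * (\<epsilon> * \<eta>\<^sup>2 / 4)) * (real (card V))\<^sup>2))"
  using assms(4,5)
proof (induction s arbitrary: \<theta>)
  case 0
  \<comment> \<open>\<open>1 / \<theta> \<le> Q\<close> makes one cluster size at most
    \<open>\<theta> * card V\<close>, which bounds the leftover.\<close>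
  define Q where "Q = nat \<lceil>1 / \<theta>\<rceil> + K\<^sub>0"
  have Q: "1 / \<theta> \<le> real Q" "0 < Q" "K\<^sub>0 \<le> Q" using assms(3) unfolding Q_def by linarith+
  show ?case
  proof (rule exI[of _ "2 * Q"], rule conjI, rule_tac [2] exI[of _ Q], (rule_tac [2] allI)+, rule_tac [2] impI)
    show "0 < 2 * Q" using Q by simp
    fix V :: "'a set" and E :: "'a \<Rightarrow> 'a \<Rightarrow> bool" assume V: "finite V \<and> Q \<le> card V"
    define N where "N = card V div Q"
    have N: "0 < N" "N * Q \<le> card V" using V Q by (auto simp: N_def div_greater_zero_iff)
    have "card V \<le> N * Q + Q"
      unfolding N_def using mod_less_divisor[OF Q(2), of "card V"] div_mult_mod_eq[of "card V" Q] by linarith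
    also have "\<dots> \<le> 2 * Q * N" using N(1) by (cases N) auto
    finally have N2: "card V \<le> 2 * Q * N" .
    obtain F where F: "clusters V N F" "card V \<le> card (\<Union>F) + N"
      using clusters_chop[of V N] V N by blast
    have "real N * (1 / \<theta>) \<le> real N * real Q" using Q by (intro mult_left_mono) auto
    also have "\<dots> \<le> real (card V)" using N(2) by (metis of_nat_le_iff of_nat_mult)
    finally have "real N \<le> \<theta> * real (card V)" using 0 by (simp add: field_simps)
    moreover have "real (card V) \<le> real (card (\<Union>F)) + real N" using F(2) by linarith
    ultimately have "(1 - \<theta>) * real (card V) \<le> real (card (\<Union>F))" by (simp add: algebra_simps)
    moreover have "N * K\<^sub>0 \<le> card V" using N(2) mult_le_mono2[OF Q(3), of N] by linarith
    moreover have "card (linked_part E F) \<le> card (V \<times> V)"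
      using linked_part_subset[OF F(1)] V by (intro card_mono) auto
    hence "real (card (linked_part E F)) \<le> (1 - real 0 * (\<epsilon> * \<eta>\<^sup>2 / 4)) * (real (card V))\<^sup>2"
      by (simp add: card_cartesian_product power2_eq_square flip: of_nat_mult)
    ultimately show "\<exists>N F. balanced V K\<^sub>0 (2 * Q) \<theta> N F \<and>
      (real (card (holes E \<eta> N F)) \<le> \<epsilon> * (real (card F))\<^sup>2
       \<or> real (card (linked_part E F)) \<le> (1 - real 0 * (\<epsilon> * \<eta>\<^sup>2 / 4)) * (real (card V))\<^sup>2)"
      using F(1) N2 unfolding balanced_def by blast
  qed
next
  case (Suc s)
  have th: "0 < \<theta> / 2" "\<theta> / 2 \<le> 1 / 2" using Suc.prems by auto
  obtain M n\<^sub>0 where M: "0 < M" and IH: "\<forall>(V :: 'a set) E. finite V \<and> n\<^sub>0 \<le> card V \<longrightarrow>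
    (\<exists>N F. balanced V K\<^sub>0 M (\<theta> / 2) N F \<and>
      (real (card (holes E \<eta> N F)) \<le> \<epsilon> * (real (card F))\<^sup>2
       \<or> real (card (linked_part E F)) \<le> (1 - real s * (\<epsilon> * \<eta>\<^sup>2 / 4)) * (real (card V))\<^sup>2))"
    using Suc.IH[OF th] by (elim exE conjE) (rule that, assumption+)
  \<comment> \<open>\<open>L\<close> bounds the number of atoms of a refinement of at most
    \<open>M\<close> clusters. As \<open>2 * L / \<theta> \<le> Q\<close>, the atoms together lose
    at most \<open>\<theta> / 2\<close> of all vertices.\<close>
  define L :: nat where "L = 2 ^ (M + 2 * M\<^sup>2)"
  define Q where "Q = nat \<lceil>2 * real L / \<theta>\<rceil> + 1"
  have Q: "2 * real L / \<theta> \<le> real Q" "0 < Q" unfolding Q_def by linarith+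
  show ?case
  \<comment> \<open>The summand \<open>M * Q\<close> forces \<open>Q \<le> N\<close>, so that the
    new size \<open>N div Q\<close> is positive. The factor 2 in the new bound pays for rounding in
    this division.\<close>
  proof (rule exI[of _ "2 * Q * M"], rule conjI, rule_tac [2] exI[of _ "n\<^sub>0 + M * Q"], (rule_tac [2] allI)+, rule_tac [2] impI)
    show "0 < 2 * Q * M" using Q M by simp
    fix V :: "'a set" and E :: "'a \<Rightarrow> 'a \<Rightarrow> bool" assume V: "finite V \<and> n\<^sub>0 + M * Q \<le> card V"
    obtain N F where "balanced V K\<^sub>0 M (\<theta> / 2) N F"
      and or: "real (card (holes E \<eta> N F)) \<le> \<epsilon> * (real (card F))\<^sup>2
       \<or> real (card (linked_part E F)) \<le> (1 - real s * (\<epsilon> * \<eta>\<^sup>2 / 4)) * (real (card V))\<^sup>2"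
      using IH[rule_format, of V E] V by auto
    hence F: "clusters V N F" "N * K\<^sub>0 \<le> card V" "card V \<le> M * N"
      "(1 - \<theta> / 2) * real (card V) \<le> real (card (\<Union>F))"
      unfolding balanced_def by auto
    show "\<exists>N F. balanced V K\<^sub>0 (2 * Q * M) \<theta> N F \<and>
      (real (card (holes E \<eta> N F)) \<le> \<epsilon> * (real (card F))\<^sup>2
       \<or> real (card (linked_part E F)) \<le> (1 - real (Suc s) * (\<epsilon> * \<eta>\<^sup>2 / 4)) * (real (card V))\<^sup>2)"
    proof (cases "real (card (holes E \<eta> N F)) \<le> \<epsilon> * (real (card F))\<^sup>2")
      case True
      have "1 * (M * N) \<le> (2 * Q) * (M * N)" using Q(2) by (intro mult_le_mono1) simp
      hence "card V \<le> 2 * Q * (M * N)" using F(3) by linarith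
      hence "card V \<le> 2 * Q * M * N" by (simp only: mult.assoc)
      moreover have "(1 - \<theta>) * real (card V) \<le> (1 - \<theta> / 2) * real (card V)"
        using Suc.prems by (intro mult_right_mono) auto
      ultimately have "(1 - \<theta>) * real (card V) \<le> real (card (\<Union>F))" "card V \<le> 2 * Q * M * N"
        using F(4) by linarith+
      thus ?thesis using True F(1,2) unfolding balanced_def by blast
    next
      case False
      define n where "n = real (card V)"
      have QN: "Q \<le> N"
      proof -
        have "M * Q \<le> M * N" using V F(3) by linarith
        thus ?thesis using M by simp
      qed
      define N' where "N' = N div Q"
      have N': "0 < N'" "N' * Q \<le> N" using QN Q by (auto simp: N'_def div_greater_zero_iff)
      have "N \<le> N' * Q + Q"
        unfolding N'_def using mod_less_divisor[OF Q(2), of N] div_mult_mod_eq[of N Q] by linarith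
      also have "\<dots> \<le> 2 * Q * N'" using N'(1) by (cases N') auto
      finally have "M * N \<le> M * (2 * Q * N')" by simp
      hence "card V \<le> M * (2 * Q * N')" using F(3) by linarith
      hence 1: "card V \<le> 2 * Q * M * N'" by (simp add: algebra_simps)
      have "N' * 1 \<le> N' * Q" using Q(2) by (intro mult_le_mono2) auto
      hence "N' \<le> N" using N'(2) by linarith
      hence 2: "N' * K\<^sub>0 \<le> card V" using F(2) mult_le_mono1[of N' N K\<^sub>0] by linarith
      have UF: "card (\<Union>F) = card F * N" using F(1) V by (intro card_Union_clusters) auto
      have "card (\<Union>F) \<le> card V" using V clusters_Union[OF F(1)] by (intro card_mono) auto
      hence "card F * N \<le> M * N" using UF F(3) by linarith
      hence FM: "card F \<le> M" using QN Q by simp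
      have "0 \<le> \<eta> * real N" using assms by simp
      from clusters_refine[OF F(1) _ N'(1) this holes_def] V
      obtain F' where F': "clusters V N' F'" "card (\<Union>F) \<le> card (\<Union>F') + 2 ^ (card F + 2 * (card F)\<^sup>2) * N'"
        "real (card (linked_part E F')) + real (card (holes E \<eta> N F)) * (\<eta> * real N)\<^sup>2 \<le> real (card (linked_part E F))"
        by blast
      have "card F + 2 * (card F)\<^sup>2 \<le> M + 2 * M\<^sup>2"
        using FM by (intro add_mono mult_left_mono power_mono) auto
      hence "(2::nat) ^ (card F + 2 * (card F)\<^sup>2) \<le> L" unfolding L_def by (intro power_increasing) auto
      hence "card (\<Union>F) \<le> card (\<Union>F') + L * N'" using F'(2) mult_le_mono1[of _ L N'] by (meson add_left_mono le_trans)
      hence u: "real (card (\<Union>F)) \<le> real (card (\<Union>F')) + real L * real N'"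
        by (metis of_nat_add of_nat_mono of_nat_mult)
      have "N * 1 \<le> N * K\<^sub>0" using assms(3) by (intro mult_le_mono2) auto
      hence "N' * Q \<le> card V" using N'(2) F(2) by linarith
      hence "real N' * real Q \<le> n" unfolding n_def by (metis of_nat_le_iff of_nat_mult)
      moreover have "real N' * (2 * real L / \<theta>) \<le> real N' * real Q" using Q by (intro mult_left_mono) auto
      ultimately have "real N' * (2 * real L / \<theta>) \<le> n" by linarith
      hence "real L * real N' \<le> \<theta> / 2 * n" using Suc.prems by (simp add: field_simps)
      moreover have "n - \<theta> / 2 * n \<le> real (card (\<Union>F))" using F(4) unfolding n_def by (simp add: algebra_simps)
      ultimately have 3: "(1 - \<theta>) * n \<le> real (card (\<Union>F'))" using u by (simp add: algebra_simps)
      \<comment> \<open>At least half of the vertices are covered, so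
        \<open>card F * N \<ge> n / 2\<close>; squaring this is the source of the factor
        \<open>1 / 4\<close> in the decrement.\<close>
      have "1/2 * n \<le> (1 - \<theta> / 2) * n"
        using Suc.prems by (intro mult_right_mono) (auto simp: n_def)
      hence "1/2 * n \<le> real (card F) * real N" using F(4) UF unfolding n_def by simp
      hence "(1/2 * n)\<^sup>2 \<le> (real (card F) * real N)\<^sup>2" by (intro power_mono) (auto simp: n_def)
      hence "\<epsilon> * \<eta>\<^sup>2 * (1/2 * n)\<^sup>2 \<le> \<epsilon> * \<eta>\<^sup>2 * (real (card F) * real N)\<^sup>2"
        using assms(2) by (intro mult_left_mono) auto
      moreover have "\<epsilon> * (real (card F))\<^sup>2 * (\<eta> * real N)\<^sup>2 \<le> real (card (holes E \<eta> N F)) * (\<eta> * real N)\<^sup>2"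
        using False by (intro mult_right_mono) auto
      moreover have "\<epsilon> * \<eta>\<^sup>2 * (1/2 * n)\<^sup>2 = \<epsilon> * \<eta>\<^sup>2 / 4 * n\<^sup>2"
        by (simp add: power2_eq_square)
      moreover have "\<epsilon> * \<eta>\<^sup>2 * (real (card F) * real N)\<^sup>2 = \<epsilon> * (real (card F))\<^sup>2 * (\<eta> * real N)\<^sup>2"
        by (simp add: power_mult_distrib)
      ultimately have "\<epsilon> * \<eta>\<^sup>2 / 4 * n\<^sup>2 \<le> real (card (holes E \<eta> N F)) * (\<eta> * real N)\<^sup>2"
        by linarith
      moreover have "real (card (linked_part E F)) \<le> (1 - real s * (\<epsilon> * \<eta>\<^sup>2 / 4)) * n\<^sup>2"
        using or False unfolding n_def by blast
      moreover have "(1 - real (Suc s) * (\<epsilon> * \<eta>\<^sup>2 / 4)) * n\<^sup>2 = (1 - real s * (\<epsilon> * \<eta>\<^sup>2 / 4)) * n\<^sup>2 - \<epsilon> * \<eta>\<^sup>2 / 4 * n\<^sup>2"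
        by (simp add: algebra_simps)
      ultimately have "real (card (linked_part E F')) \<le> (1 - real (Suc s) * (\<epsilon> * \<eta>\<^sup>2 / 4)) * n\<^sup>2"
        using F'(3) by linarith
      thus ?thesis using F'(1) 1 2 3 unfolding n_def balanced_def by blast
    qed
  qed
qed

text \<open>After enough rounds the bound on the linked area would be negative, so that only the
  alternative with few holes is left.\<close>

lemma clusters_without_holes:
  fixes \<eta> \<epsilon> \<theta> :: real and K\<^sub>0 :: nat
  assumes "0 < \<eta>" "0 < \<epsilon>" "0 < K\<^sub>0" "0 < \<theta>" "\<theta> \<le> 1/2"
  obtains M n\<^sub>0 where "0 < M"
    and "\<And>(V :: 'a set) E. finite V \<Longrightarrow> n\<^sub>0 \<le> card V \<Longrightarrow>
    \<exists>N F. balanced V K\<^sub>0 M \<theta> N F \<and> real (card (holes E \<eta> N F)) \<le> \<epsilon> * (real (card F))\<^sup>2"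
proof -
  define c where "c = \<epsilon> * \<eta>\<^sup>2 / 4"
  have "0 < c" using assms by (simp add: c_def)
  obtain s where s: "1 < real s * c" using reals_Archimedean3[OF \<open>0 < c\<close>] by blast
  obtain M n\<^sub>0 where M: "0 < M" and it: "\<forall>(V :: 'a set) E. finite V \<and> n\<^sub>0 \<le> card V \<longrightarrow>
    (\<exists>N F. balanced V K\<^sub>0 M \<theta> N F \<and>
      (real (card (holes E \<eta> N F)) \<le> \<epsilon> * (real (card F))\<^sup>2
       \<or> real (card (linked_part E F)) \<le> (1 - real s * c) * (real (card V))\<^sup>2))"
    using clusters_iterate[OF assms, of s, where 'a = 'a, folded c_def]
    by (elim exE conjE) (rule that, assumption+)
  show ?thesis
  \<comment> \<open>\<open>Suc\<close> makes \<open>V\<close> nonempty, so that the bound is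
    strictly negative.\<close>
  proof (rule that[OF M, of "Suc n\<^sub>0"])
    fix V :: "'a set" and E assume V: "finite V" "Suc n\<^sub>0 \<le> card V"
    hence "(1 - real s * c) * (real (card V))\<^sup>2 < 0" using s by (intro mult_neg_pos) auto
    hence "\<not> real k \<le> (1 - real s * c) * (real (card V))\<^sup>2" for k :: nat
      by (meson not_le of_nat_0_le_iff order_less_le_trans)
    thus "\<exists>N F. balanced V K\<^sub>0 M \<theta> N F \<and> real (card (holes E \<eta> N F)) \<le> \<epsilon> * (real (card F))\<^sup>2"
      using it[rule_format, of V E] V by auto
  qed
qed

subsection \<open>Long cycles along a cycle of clusters\<close>

text \<open>
  Depth-first search after \<open>k\<close> moves: \<open>S\<close> holds the finished vertices, \<open>P\<close> is the stack with the current
  vertex first, \<open>U\<close> holds the unvisited vertices. Every move increases \<open>card S - card U\<close> by one.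
\<close>

lemma dfs_state:
  assumes "finite W" "k \<le> 2 * card W"
  shows "\<exists>S P U. W = S \<union> set P \<union> U \<and> S \<inter> set P = {} \<and> S \<inter> U = {} \<and> set P \<inter> U = {} \<and>
    distinct P \<and> successively (\<lambda>x y. E y x) P \<and> \<not> linked E S U \<and> card S + card W = k + card U"
  using assms(2)
proof (induction k)
  case 0
  show ?case by (intro exI[of _ "{}"] exI[of _ "[]"] exI[of _ W]) (simp add: linked_def)
next
  case (Suc k)
  then obtain S P U where W: "W = S \<union> set P \<union> U" "S \<inter> set P = {}" "S \<inter> U = {}" "set P \<inter> U = {}"
    and P: "distinct P" "successively (\<lambda>x y. E y x) P" and no: "\<not> linked E S U"
    and k: "card S + card W = k + card U"
    by (auto simp del: successively.simps)
  have fin: "finite S" "finite U" using assms(1) W(1) by auto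
  show ?case
  proof (cases "\<exists>u\<in>U. P = [] \<or> E (hd P) u")
    \<comment> \<open>Push an unvisited out-neighbour of the current vertex, or any unvisited vertex
      if the stack is empty.\<close>
    case True
    then obtain u where u: "u \<in> U" "P = [] \<or> E (hd P) u" by blast
    have "card U = Suc (card (U - {u}))" using fin(2) u(1) by (metis card_Suc_Diff1)
    moreover have "W = S \<union> set (u # P) \<union> (U - {u})" "S \<inter> set (u # P) = {}" "S \<inter> (U - {u}) = {}"
      "set (u # P) \<inter> (U - {u}) = {}" "distinct (u # P)"
      using W P(1) u(1) by auto
    moreover have "successively (\<lambda>x y. E y x) (u # P)" using P(2) u(2) by (cases P) auto
    moreover have "\<not> linked E S (U - {u})" using no unfolding linked_def by blast
    moreover have "card S + card W = Suc k + card (U - {u})" using k calculation(1) by linarith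
    ultimately show ?thesis by blast
  next
    case False
    show ?thesis
    proof (cases P)
      \<comment> \<open>With nothing left to push or pop, all \<open>2 * card W\<close> moves have
        been made.\<close>
      case Nil
      hence "U = {}" using False by blast
      hence "card S + card W = k" "W = S" using k W Nil by auto
      thus ?thesis using Suc.prems by simp
    next
      case (Cons v Q)
      have "card (insert v S) = Suc (card S)" using W(2) Cons fin by simp
      hence "card (insert v S) + card W = Suc k + card U" using k by simp
      moreover have "W = insert v S \<union> set Q \<union> U" "insert v S \<inter> set Q = {}" "insert v S \<inter> U = {}" "set Q \<inter> U = {}"
        using W P Cons by auto
      moreover have "distinct Q" "successively (\<lambda>x y. E y x) Q"
        using P Cons by (cases Q; auto)+
      moreover have "\<not> linked E (insert v S) U" using no False Cons unfolding linked_def by auto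
      ultimately show ?thesis by blast
    qed
  qed
qed

text \<open>The state after \<open>card W\<close> moves, half of the total, where
  \<open>card S = card U\<close>. Reversing the stack gives a path in the direction of the
  edges.\<close>

lemma balanced_dfs_path:
  assumes "finite W"
  obtains S P U where "W = S \<union> set P \<union> U" "S \<inter> set P = {}" "S \<inter> U = {}" "set P \<inter> U = {}"
    "distinct P" "\<And>i. Suc i < length P \<Longrightarrow> E (P ! i) (P ! Suc i)" "\<not> linked E S U" "card S = card U"
proof -
  obtain S P U where W: "W = S \<union> set P \<union> U" "S \<inter> set P = {}" "S \<inter> U = {}" "set P \<inter> U = {}"
    and P: "distinct P" "successively (\<lambda>x y. E y x) P" and no: "\<not> linked E S U"
    and k: "card S + card W = card W + card U"
    using dfs_state[OF assms, of "card W" E] by (auto simp del: successively.simps)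
  have "successively E (rev P)" using P(2) by simp
  hence "E (rev P ! i) (rev P ! Suc i)" if "Suc i < length (rev P)" for i
    using that by (simp add: successively_conv_nth)
  thus ?thesis using that[of S "rev P" U] W P k no by simp
qed

section \<open>Paths and cycles in a blow-up of a cycle\<close>

lemma card_residue_class:
  fixes m :: nat
  assumes "0 < m"
  shows "card {j. j < l \<and> (c + j) mod m = i} \<le> l div m + 1"
proof -
  have "inj_on (\<lambda>j. j div m) {j. j < l \<and> (c + j) mod m = i}"
  proof (rule inj_onI)
    fix x y assume xy: "x \<in> {j. j < l \<and> (c + j) mod m = i}" "y \<in> {j. j < l \<and> (c + j) mod m = i}"
      and d: "x div m = y div m"
    have "(c + x) mod m = (c + y) mod m" using xy by simp
    \<comment> \<open>Adding \<open>m * c - c\<close> turns the offset \<open>c\<close> into a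
      multiple of \<open>m\<close>, which cancels \<open>c\<close> without a subtraction.\<close>
    hence "(c + x + (m * c - c)) mod m = (c + y + (m * c - c)) mod m"
      by (rule mod_add_cong[OF _ refl])
    moreover have "c \<le> m * c" using assms by simp
    hence "c + z + (m * c - c) = z + m * c" for z by linarith
    ultimately have "x mod m = y mod m" by simp
    thus "x = y" using d by (metis div_mult_mod_eq)
  qed
  hence "card {j. j < l \<and> (c + j) mod m = i} \<le> card {..l div m}"
    by (rule card_inj_on_le) (auto intro: div_le_mono)
  thus ?thesis by simp
qed

locale blowup =
  fixes E :: "'a \<Rightarrow> 'a \<Rightarrow> bool" and X :: "nat \<Rightarrow> 'a set" and m N :: nat and k :: real
  assumes m: "0 < m"
    and disj: "\<And>i j. i < m \<Longrightarrow> j < m \<Longrightarrow> i \<noteq> j \<Longrightarrow> X i \<inter> X j = {}"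
    and fin: "\<And>i. i < m \<Longrightarrow> finite (X i)"
    and N: "\<And>i. i < m \<Longrightarrow> card (X i) = N"
    and no_hole: "\<And>i. i < m \<Longrightarrow> \<not> hole E k (X i) (X (Suc i mod m))"
begin

text \<open>Using only edges that advance by one class makes every path go round the classes in
  order, so that it uses them equally up to one vertex.\<close>

definition step :: "'a \<Rightarrow> 'a \<Rightarrow> bool" where
  "step x y \<longleftrightarrow> E x y \<and> (\<exists>i<m. x \<in> X i \<and> y \<in> X (Suc i mod m))"

lemma class_unique: "i < m \<Longrightarrow> j < m \<Longrightarrow> x \<in> X i \<Longrightarrow> x \<in> X j \<Longrightarrow> i = j"
  using disj by blast

lemma path_classes:
  assumes "set P \<subseteq> (\<Union>i<m. X i)" "\<And>i. Suc i < length P \<Longrightarrow> step (P ! i) (P ! Suc i)"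
  obtains c where "\<And>j. j < length P \<Longrightarrow> P ! j \<in> X ((c + j) mod m)"
proof (cases "P = []")
  case True
  thus ?thesis using that by simp
next
  case False
  hence "P ! 0 \<in> (\<Union>i<m. X i)" using assms(1) by (simp add: subset_iff)
  then obtain c where c: "c < m" "P ! 0 \<in> X c" by blast
  have "j < length P \<Longrightarrow> P ! j \<in> X ((c + j) mod m)" for j
  proof (induction j)
    case 0
    thus ?case using c by simp
  next
    case (Suc j)
    hence j: "P ! j \<in> X ((c + j) mod m)" by simp
    obtain i where i: "i < m" "P ! j \<in> X i" "P ! Suc j \<in> X (Suc i mod m)"
      using assms(2)[OF Suc.prems] unfolding step_def by blast
    have "i = (c + j) mod m" using class_unique[OF i(1) _ i(2) j] m by simp
    thus ?case using i(3) by (simp add: mod_Suc_eq)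
  qed
  thus ?thesis by (rule that)
qed

lemma card_split:
  assumes "S \<subseteq> (\<Union>i<m. X i)"
  shows "card S = (\<Sum>i<m. card (S \<inter> X i))"
proof -
  have "S = (\<Union>i<m. S \<inter> X i)" using assms by blast
  hence "card S = card (\<Union>i<m. S \<inter> X i)" by (rule arg_cong)
  also have "\<dots> = (\<Sum>i<m. card (S \<inter> X i))"
  proof (rule card_UN_disjoint)
    show "\<forall>i\<in>{..<m}. \<forall>j\<in>{..<m}. i \<noteq> j \<longrightarrow> S \<inter> X i \<inter> (S \<inter> X j) = {}"
      using disj by blast
  qed (use fin in auto)
  finally show ?thesis .
qed

lemma closed_under_Suc:
  assumes "i < m" "Q i" "\<And>i. i < m \<Longrightarrow> Q i \<Longrightarrow> Q (Suc i mod m)" "j < m"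
  shows "Q j"
proof -
  have *: "Q ((i + t) mod m)" for t
  proof (induction t)
    case 0
    thus ?case using assms by simp
  next
    case (Suc t)
    thus ?case using assms(3)[of "(i + t) mod m"] m by (simp add: mod_Suc_eq)
  qed
  have "(i + (m - i + j)) mod m = j" using assms by simp
  thus ?thesis using *[of "m - i + j"] by simp
qed

text \<open>
  If the path is short, every class meets \<open>S\<close> or \<open>U\<close> in at least \<open>k\<close> vertices. As no edge goes from \<open>S\<close>
  to \<open>U\<close>, a class that meets \<open>S\<close> so often is followed by one that does not meet \<open>U\<close> so often; going
  around the cycle, the same alternative holds for all classes, against \<open>card S = card U\<close>.
\<close>

lemma long_path:
  obtains P c where "distinct P" "set P \<subseteq> (\<Union>i<m. X i)"
    "\<And>i. Suc i < length P \<Longrightarrow> E (P ! i) (P ! Suc i)"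
    "\<And>j. j < length P \<Longrightarrow> P ! j \<in> X ((c + j) mod m)"
    "real N < 2 * k + real (length P div m + 1)"
proof -
  define W where "W = (\<Union>i<m. X i)"
  have "finite W" using fin by (simp add: W_def)
  then obtain S P U where W: "W = S \<union> set P \<union> U" "S \<inter> set P = {}" "S \<inter> U = {}" "set P \<inter> U = {}"
    and P: "distinct P" "\<And>i. Suc i < length P \<Longrightarrow> step (P ! i) (P ! Suc i)"
    and no: "\<not> linked step S U" and eq: "card S = card U"
    by (rule balanced_dfs_path[where E = step]) (rule that; (assumption | simp))
  have PW: "set P \<subseteq> (\<Union>i<m. X i)" using W unfolding W_def by auto
  from path_classes[OF PW P(2)]
  obtain c where c: "\<And>j. j < length P \<Longrightarrow> P ! j \<in> X ((c + j) mod m)" by blast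
  define a where "a = length P div m + 1"
  have a: "card (set P \<inter> X i) \<le> a" if i: "i < m" for i
  proof -
    have "set P \<inter> X i \<subseteq> (!) P ` {j. j < length P \<and> (c + j) mod m = i}"
    proof
      fix x assume x: "x \<in> set P \<inter> X i"
      then obtain j where j: "j < length P" "P ! j = x" by (auto simp: in_set_conv_nth)
      have "(c + j) mod m = i" using class_unique[OF _ i, of _ x] c[OF j(1)] j x m by simp
      thus "x \<in> (!) P ` {j. j < length P \<and> (c + j) mod m = i}" using j by blast
    qed
    hence "card (set P \<inter> X i) \<le> card {j. j < length P \<and> (c + j) mod m = i}"
      by (intro surj_card_le) auto
    also have "\<dots> \<le> a" unfolding a_def by (rule card_residue_class[OF m])
    finally show ?thesis .
  qed
  have "real N < 2 * k + real a"
  proof (rule ccontr)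
    assume neg: "\<not> real N < 2 * k + real a"
    \<comment> \<open>By \<open>neg\<close>, at least \<open>2 * k\<close> vertices of each class
      are off the path, and they are divided between \<open>S\<close> and \<open>U\<close>.\<close>
    have big: "k \<le> card (S \<inter> X i) \<or> k \<le> card (U \<inter> X i)" if i: "i < m" for i
    proof -
      have "X i = (S \<inter> X i) \<union> (set P \<inter> X i) \<union> (U \<inter> X i)"
        using W(1) i unfolding W_def by blast
      hence "N = card ((S \<inter> X i) \<union> (set P \<inter> X i) \<union> (U \<inter> X i))" using N[OF i] by simp
      also have "\<dots> \<le> card (S \<inter> X i) + card (set P \<inter> X i) + card (U \<inter> X i)"
        by (intro order.trans[OF card_Un_le] add_mono card_Un_le order.refl)
      also have "\<dots> \<le> card (S \<inter> X i) + a + card (U \<inter> X i)" using a[OF i] by simp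
      finally have "real N \<le> real (card (S \<inter> X i)) + real a + real (card (U \<inter> X i))"
        by (metis of_nat_add of_nat_mono)
      thus ?thesis using neg by linarith
    qed
    have noedge: False if i: "i < m" "k \<le> card (S \<inter> X i)" "k \<le> card (U \<inter> X (Suc i mod m))" for i
    proof -
      have "linked E (S \<inter> X i) (U \<inter> X (Suc i mod m))"
      proof (rule ccontr)
        assume "\<not> ?thesis"
        hence "hole E k (X i) (X (Suc i mod m))"
          unfolding hole_def using i(2,3)
          by (intro exI[of _ "S \<inter> X i"] exI[of _ "U \<inter> X (Suc i mod m)"]) auto
        thus False using no_hole[OF i(1)] by blast
      qed
      hence "linked step S U" using i(1) unfolding linked_def step_def by blast
      thus False using no by blast
    qed
    have sub: "S \<subseteq> (\<Union>i<m. X i)" "U \<subseteq> (\<Union>i<m. X i)" using W(1) unfolding W_def by auto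
    \<comment> \<open>Summing over the classes would give \<open>card B < card A\<close>.\<close>
    have contr: False if "A \<subseteq> (\<Union>i<m. X i)" "B \<subseteq> (\<Union>i<m. X i)" "card A = card B"
      "\<And>i. i < m \<Longrightarrow> k \<le> card (A \<inter> X i)" "\<And>i. i < m \<Longrightarrow> \<not> k \<le> card (B \<inter> X i)" for A B
    proof -
      have "(\<Sum>i<m. real (card (B \<inter> X i))) < (\<Sum>i<m. real (card (A \<inter> X i)))"
        using that(4,5) m by (intro sum_strict_mono) (auto, force)
      thus False using card_split[OF that(1)] card_split[OF that(2)] that(3) by (simp flip: of_nat_sum)
    qed
    show False
    proof (cases "\<exists>i<m. k \<le> card (S \<inter> X i)")
      case True
      then obtain i where i: "i < m" "k \<le> card (S \<inter> X i)" by blast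
      have all: "k \<le> card (S \<inter> X j)" if "j < m" for j
        using i(1) i(2) _ that
      proof (rule closed_under_Suc[where Q = "\<lambda>j. k \<le> card (S \<inter> X j)"])
        fix i assume "i < m" "k \<le> card (S \<inter> X i)"
        thus "k \<le> card (S \<inter> X (Suc i mod m))" using noedge[of i] big[of "Suc i mod m"] m by auto
      qed
      have "\<not> k \<le> card (U \<inter> X j)" if "j < m" for j
      proof -
        define i where "i = (if j = 0 then m - 1 else j - 1)"
        have "i < m" "Suc i mod m = j" using that by (auto simp: i_def)
        thus ?thesis using noedge[of i] all[of i] by auto
      qed
      thus False using contr[of S U] sub eq all by blast
    next
      \<comment> \<open>No class meets \<open>S\<close> in \<open>k\<close> vertices, so by
        \<open>big\<close> every class meets \<open>U\<close> in that many.\<close>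
      case False
      thus False using contr[of U S] sub eq big by (metis)
    qed
  qed
  moreover have "E (P ! i) (P ! Suc i)" if "Suc i < length P" for i
    using P(2)[OF that] unfolding step_def by simp
  ultimately show ?thesis using that[of P c] P(1) PW c unfolding a_def by simp
qed

text \<open>
  The first and the last \<open>m b\<close> vertices of a long path each contain \<open>b \<ge> k\<close> vertices of every class, so
  some edge closes the path at the cost of at most \<open>2 m b\<close> vertices.
\<close>

lemma long_cycle:
  assumes "2 \<le> m" "0 \<le> k" "4 * k + 6 \<le> real N"
  shows "\<exists>ys. cyc E ys \<and> real m * (real N - 4 * k - 5) \<le> real (length ys) \<and> 2 \<le> length ys"
proof -
  obtain P c where P: "distinct P" "\<And>i. Suc i < length P \<Longrightarrow> E (P ! i) (P ! Suc i)"
    and c: "\<And>j. j < length P \<Longrightarrow> P ! j \<in> X ((c + j) mod m)"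
    and len: "real N < 2 * k + real (length P div m + 1)"
    by (rule long_path) (rule that; (assumption | simp))
  define l where "l = length P"
  \<comment> \<open>From \<open>b \<le> k + 2\<close> and \<open>q > N - 2 * k - 1\<close> follows
    \<open>q - 2 * b > N - 4 * k - 5\<close>, the length per class in the conclusion.\<close>
  define b where "b = nat \<lceil>k\<rceil> + 1"
  have b: "k \<le> real b" "real b \<le> k + 2" using assms(2) unfolding b_def by linarith+
  define q where "q = l div m"
  have q: "real N < 2 * k + real q + 1" using len unfolding q_def l_def by simp
  hence "2 * b + 1 \<le> q" using b(2) assms(3) by linarith
  hence "m * (2 * b + 1) \<le> m * q" by (rule mult_le_mono2)
  also have mq: "m * q \<le> l" unfolding q_def by simp
  finally have mb: "2 * (m * b) + m \<le> l" by (simp add: algebra_simps)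
  have mt: "m * t + m \<le> m * b" if "t < b" for t
    using mult_le_mono2[of "Suc t" b m] that by simp
  have lm: "l mod m < m" using m by simp
  define i where "i = (c + (l - 1)) mod m"
  have i: "i < m" "Suc i mod m = (c + l) mod m"
    using m mb by (auto simp: i_def mod_Suc_eq)
  \<comment> \<open>\<open>A\<close> goes back from the last vertex in strides of \<open>m\<close>
    and stays in its class \<open>i\<close>. \<open>B\<close> starts at index
    \<open>l mod m\<close>, which is congruent to \<open>l\<close>, and so stays in the class after
    \<open>i\<close>.\<close>
  define A where "A = (\<lambda>t. P ! (l - 1 - m * t)) ` {..<b}"
  define B where "B = (\<lambda>t. P ! (l mod m + m * t)) ` {..<b}"
  have "inj_on (\<lambda>t. P ! (l - 1 - m * t)) {..<b}"
  proof (rule inj_onI)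
    fix s t assume st: "s \<in> {..<b}" "t \<in> {..<b}" "P ! (l - 1 - m * s) = P ! (l - 1 - m * t)"
    have "m * s + m \<le> l" "m * t + m \<le> l" using mt[of s] mt[of t] st mb by auto
    moreover from this have "l - 1 - m * s = l - 1 - m * t"
      using st(3) P(1) m by (subst (asm) nth_eq_iff_index_eq) (auto simp: l_def)
    ultimately have "m * s = m * t" using m by linarith
    thus "s = t" using m by simp
  qed
  hence cA: "card A = b" by (simp add: A_def card_image)
  have "inj_on (\<lambda>t. P ! (l mod m + m * t)) {..<b}"
  proof (rule inj_onI)
    fix s t assume st: "s \<in> {..<b}" "t \<in> {..<b}" "P ! (l mod m + m * s) = P ! (l mod m + m * t)"
    have "l mod m + m * s < l" "l mod m + m * t < l" using mt[of s] mt[of t] st mb lm by auto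
    hence "l mod m + m * s = l mod m + m * t"
      using st(3) P(1) by (subst (asm) nth_eq_iff_index_eq) (auto simp: l_def)
    thus "s = t" using m by simp
  qed
  hence cB: "card B = b" by (simp add: B_def card_image)
  have "A \<subseteq> X i"
  proof
    fix x assume "x \<in> A"
    then obtain t where t: "t < b" "x = P ! (l - 1 - m * t)" by (auto simp: A_def)
    have j: "l - 1 - m * t < length P" using mb m unfolding l_def[symmetric] by linarith
    have "c + (l - 1) = c + (l - 1 - m * t) + m * t" using mt[OF t(1)] mb m by simp
    hence "i = (c + (l - 1 - m * t)) mod m" unfolding i_def by (metis mod_mult_self2)
    thus "x \<in> X i" using c[OF j] t(2) by simp
  qed
  moreover have "B \<subseteq> X (Suc i mod m)"
  proof
    fix x assume "x \<in> B"
    then obtain t where t: "t < b" "x = P ! (l mod m + m * t)" by (auto simp: B_def)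
    have j: "l mod m + m * t < length P" using mt[OF t(1)] mb lm unfolding l_def[symmetric] by linarith
    have "(c + (l mod m + m * t)) mod m = (c + l) mod m"
      by (metis add.assoc mod_add_right_eq mod_mult_self2)
    thus "x \<in> X (Suc i mod m)" using c[OF j] t(2) i by simp
  qed
  ultimately have "hole E k (X i) (X (Suc i mod m))" if "\<not> linked E A B"
    unfolding hole_def using that cA cB b(1) by (intro exI[of _ A] exI[of _ B]) simp
  hence "linked E A B" using no_hole[OF i(1)] by blast
  then obtain s t where st: "s < b" "t < b" "E (P ! (l - 1 - m * s)) (P ! (l mod m + m * t))"
    unfolding linked_def A_def B_def by auto
  define x where "x = l - 1 - m * s"
  define y where "y = l mod m + m * t"
  have exy: "E (P ! x) (P ! y)" using st(3) unfolding x_def y_def .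
  have x: "x + m * s + 1 = l" using mt[OF st(1)] mb m unfolding x_def by linarith
  have xy: "y < x" "x < l" and diff: "l \<le> x - y + 2 * (m * b)"
    using mt[OF st(1)] mt[OF st(2)] mb m lm x unfolding y_def by linarith+
  \<comment> \<open>The section of the path from index \<open>y\<close> to index \<open>x\<close>,
    closed by the edge from \<open>P ! x\<close> to \<open>P ! y\<close>.\<close>
  define ys where "ys = take (Suc (x - y)) (drop y P)"
  have lys: "length ys = Suc (x - y)" using xy by (simp add: ys_def l_def)
  have ny: "ys ! j = P ! (y + j)" if "j < Suc (x - y)" for j
    using that xy by (simp add: ys_def l_def)
  have "E (ys ! j) (ys ! (Suc j mod length ys))" if j: "j < length ys" for j
  proof (cases "j = x - y")
    case True
    hence "ys ! j = P ! x" "Suc j mod length ys = 0" using ny[of j] lys xy(1) by simp_all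
    thus ?thesis using ny[of 0] exy by simp
  next
    case False
    hence "Suc j < Suc (x - y)" using j lys by simp
    thus ?thesis using ny[of j] ny[of "Suc j"] lys xy P(2)[of "y + j"] by (simp add: l_def)
  qed
  hence "cyc E ys" using P(1) lys xy unfolding cyc_def by (auto simp: ys_def)
  moreover have "real m * (real N - 4 * k - 5) \<le> real (length ys)"
  proof -
    have "real m * (real N - 4 * k - 5) \<le> real m * (real q - 2 * real b)"
      using q b by (intro mult_left_mono) auto
    also have "\<dots> = real (m * q) - real (2 * (m * b))" by (simp add: algebra_simps)
    also have "\<dots> \<le> real l - real (2 * (m * b))" using mq by (metis diff_right_mono of_nat_mono)
    also have "\<dots> \<le> real (length ys)" using diff lys by linarith
    finally show ?thesis .
  qed
  moreover have "2 \<le> length ys" using lys xy by simp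
  ultimately show ?thesis by blast
qed

end

section \<open>From cycles of vertices to cycles of arcs\<close>

fun arcs_along :: "('a \<Rightarrow> 'a \<Rightarrow> 'b) \<Rightarrow> 'a list \<Rightarrow> 'b list" where
  "arcs_along f (x # y # xs) = f x y # arcs_along f (y # xs)" |
  "arcs_along f xs = []"

lemma length_arcs_along: "length (arcs_along f xs) = length xs - 1"
  by (induction f xs rule: arcs_along.induct) auto

lemma (in wf_digraph) awalk_arcs_along:
  assumes "xs \<noteq> []" "hd xs \<in> verts G"
    and "successively (\<lambda>x y. f x y \<in> arcs G \<and> tail G (f x y) = x \<and> head G (f x y) = y) xs"
  shows "awalk (hd xs) (arcs_along f xs) (last xs) \<and> awalk_verts (hd xs) (arcs_along f xs) = xs"
  using assms
proof (induction f xs rule: arcs_along.induct)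
  case (1 f x y xs)
  hence "f x y \<in> arcs G" and hd: "head G (f x y) = y" by auto
  hence "y \<in> verts G" using head_in_verts[of "f x y"] unfolding hd by blast
  thus ?case using 1 by (auto simp: awalk_Cons_iff)
qed (auto simp: awalk_Nil_iff)

text \<open>Appending the first vertex closes the walk, and choosing an arc for each consecutive
  pair gives the arc list. The length bound excludes the single vertices that \<open>cyc\<close>
  admits.\<close>

lemma (in wf_digraph) cycle_of_cyc:
  assumes "cyc (\<lambda>x y. \<exists>a\<in>arcs G. tail G a = x \<and> head G a = y) ys" "2 \<le> length ys"
  shows "\<exists>c. cycle c \<and> length c = length ys"
proof -
  let ?E = "\<lambda>x y. \<exists>a\<in>arcs G. tail G a = x \<and> head G a = y"
  define f where "f x y = (SOME a. a \<in> arcs G \<and> tail G a = x \<and> head G a = y)" for x y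
  have f: "f x y \<in> arcs G \<and> tail G (f x y) = x \<and> head G (f x y) = y" if "?E x y" for x y
    unfolding f_def using that by (intro someI_ex[of "\<lambda>a. a \<in> arcs G \<and> tail G a = x \<and> head G a = y"]) blast
  let ?n = "length ys"
  define xs where "xs = ys @ [hd ys]"
  have ys: "ys \<noteq> []" "distinct ys" "\<And>i. i < ?n \<Longrightarrow> ?E (ys ! i) (ys ! (Suc i mod ?n))"
    using assms unfolding cyc_def by auto
  have succ: "?E (xs ! i) (xs ! Suc i)" if "i < ?n" for i
    using ys(3)[OF that] that ys(1) by (cases "Suc i = ?n") (auto simp: xs_def nth_append hd_conv_nth)
  have "successively ?E xs"
    unfolding successively_conv_nth using succ by (auto simp: xs_def)
  hence "successively (\<lambda>x y. f x y \<in> arcs G \<and> tail G (f x y) = x \<and> head G (f x y) = y) xs"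
    by (rule successively_mono) (use f in auto)
  moreover have "hd xs = hd ys" "last xs = hd ys" "xs \<noteq> []" using ys(1) by (auto simp: xs_def)
  moreover have "hd ys \<in> verts G"
  proof -
    obtain a where "a \<in> arcs G" "tail G a = ys ! 0" using ys(1) ys(3)[of 0] by auto
    thus ?thesis using tail_in_verts[of a] ys(1) by (simp add: hd_conv_nth)
  qed
  ultimately have *: "awalk (hd ys) (arcs_along f xs) (hd ys)" "awalk_verts (hd ys) (arcs_along f xs) = xs"
    using awalk_arcs_along[of xs f] by auto
  have "distinct (tl xs)" using ys(1,2) by (cases ys) (auto simp: xs_def)
  moreover have "length (arcs_along f xs) = ?n" by (simp add: length_arcs_along xs_def)
  moreover from this have "arcs_along f xs \<noteq> []" using ys(1) by auto
  ultimately show ?thesis using * unfolding cycle_def by metis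
qed

subsection \<open>Subgraphs of pseudorandom digraphs\<close>

text \<open>
  Pseudorandomness gives no direct bound on the arcs inside a cluster or outside all clusters. They are
  bounded by subtracting the arcs between distinct clusters from the total.
\<close>

lemma arcs_le_linked_pairs:
  fixes G G' :: "('a, 'b) pre_digraph" and p r \<mu> :: real
  assumes dg: "digraph G" and sub: "subgraph G' G" and pr: "pseudorandom G p r"
    and p: "0 \<le> p" and r: "r \<le> \<mu> * sqrt (real (card (verts G)) * p)"
    and cl: "clusters (verts G) N F"
  defines "E \<equiv> \<lambda>x y. \<exists>a\<in>arcs G'. tail G' a = x \<and> head G' a = y"
  defines "n \<equiv> real (card (verts G))"
  defines "L \<equiv> {(X, Y). X \<in> F \<and> Y \<in> F \<and> X \<noteq> Y \<and> linked E X Y}"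
  shows "real (card (arcs G')) \<le> p * (n\<^sup>2
    - real (card F) * (real (card F) - 1) * ((real N)\<^sup>2 - \<mu> * n * real N)
    + real (card L) * ((real N)\<^sup>2 + \<mu> * n * real N))"
proof -
  interpret G: digraph G by (rule dg)
  have fV: "finite (verts G)" and fA: "finite (arcs G)" by auto
  have fF: "finite F" using cl fV by (rule clusters_finite)
  define D where "D = {(X, Y). X \<in> F \<and> Y \<in> F \<and> X \<noteq> Y}"
  define e where "e = (\<lambda>(X, Y). {a \<in> arcs G. tail G a \<in> X \<and> head G a \<in> Y})"
  \<comment> \<open>The error \<open>r * N * sqrt (p * n)\<close> of pseudorandomness at the largest
    \<open>r\<close> allowed.\<close>
  define q where "q = real N * (\<mu> * n * p)"
  have "D \<subseteq> F \<times> F" by (auto simp: D_def)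
  hence fD: "finite D" using fF finite_subset by blast
  have LD: "L \<subseteq> D" by (auto simp: L_def D_def)
  hence fL: "finite L" using fD by (rule finite_subset)
  have e: "\<bar>real (card (e P)) - p * (real N)\<^sup>2\<bar> \<le> q" if P: "P \<in> D" for P
  proof -
    obtain X Y where XY: "P = (X, Y)" "X \<in> F" "Y \<in> F" "X \<noteq> Y" using P by (auto simp: D_def)
    have cN: "card X = N" "card Y = N" and XV: "X \<subseteq> verts G" "Y \<subseteq> verts G" and dis: "X \<inter> Y = {}"
      using cl XY unfolding clusters_def pairwise_def disjnt_def by auto
    have "\<bar>real (e_between G X Y) - p * real (card X) * real (card Y)\<bar> \<le> r * real (card X) * sqrt (p * n)"
      using pr XV dis cN(1) cN(2)[symmetric] unfolding pseudorandom_def n_def by simp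
    moreover have "e_between G X Y = card (e P)" by (simp add: XY(1) e_def e_between_def)
    ultimately have "\<bar>real (card (e P)) - p * (real N)\<^sup>2\<bar> \<le> r * (real N * sqrt (p * n))"
      by (simp add: cN power2_eq_square mult.assoc)
    also have "\<dots> \<le> (\<mu> * sqrt (n * p)) * (real N * sqrt (p * n))"
      using r p unfolding n_def by (intro mult_right_mono) auto
    also have "\<dots> = q"
      using p unfolding q_def n_def by (simp add: mult.commute[of p] mult.left_commute)
    finally show ?thesis .
  qed
  have fe: "finite (e P)" for P
    using fA by (auto simp: e_def split: prod.split intro: finite_subset)
  have card_e: "card (\<Union>P\<in>D'. e P) = (\<Sum>P\<in>D'. card (e P))" if D': "D' \<subseteq> D" for D'
  proof (rule card_UN_disjoint)
    show "finite D'" using D' fD by (rule finite_subset)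
    show "\<forall>P\<in>D'. \<forall>Q\<in>D'. P \<noteq> Q \<longrightarrow> e P \<inter> e Q = {}"
    proof (intro ballI impI)
      fix P Q assume "P \<in> D'" "Q \<in> D'" and PQ: "P \<noteq> Q"
      hence PQD: "P \<in> D" "Q \<in> D" using D' by auto
      then obtain X Y X' Y' where XY: "P = (X, Y)" "Q = (X', Y')" "X \<in> F" "Y \<in> F" "X' \<in> F" "Y' \<in> F"
        by (auto simp: D_def)
      have "X \<inter> X' = {} \<or> Y \<inter> Y' = {}"
        using cl XY PQ unfolding clusters_def pairwise_def disjnt_def by auto
      thus "e P \<inter> e Q = {}" unfolding XY e_def by auto
    qed
  qed (use fe in blast)
  have eA: "(\<Union>P\<in>D'. e P) \<subseteq> arcs G" for D' by (auto simp: e_def)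
  have cmp: "tail G' = tail G" "head G' = head G" "arcs G' \<subseteq> arcs G"
    using sub unfolding subgraph_def compatible_def by auto
  have cD: "real (card D) = real (card F) * (real (card F) - 1)"
  proof -
    have "D = F \<times> F - (\<lambda>X. (X, X)) ` F" by (auto simp: D_def)
    moreover have "card ((\<lambda>X. (X, X)) ` F) = card F" by (intro card_image inj_onI) simp
    moreover have "(\<lambda>X. (X, X)) ` F \<subseteq> F \<times> F" by auto
    ultimately have "card D = card F * card F - card F"
      using fF by (simp add: card_Diff_subset card_cartesian_product)
    moreover have "card F \<le> card F * card F" by (cases "card F") auto
    ultimately show ?thesis by (simp add: of_nat_diff algebra_simps)
  qed
  \<comment> \<open>An arc of \<open>G'\<close> between distinct clusters makes their pair linked;
    every other arc is counted among the arcs of \<open>G\<close> that do not join distinct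
    clusters.\<close>
  have "arcs G' \<subseteq> (arcs G - (\<Union>P\<in>D. e P)) \<union> (\<Union>P\<in>L. e P)"
  proof
    fix a assume a: "a \<in> arcs G'"
    hence aG: "a \<in> arcs G" using cmp by auto
    show "a \<in> (arcs G - (\<Union>P\<in>D. e P)) \<union> (\<Union>P\<in>L. e P)"
    proof (cases "a \<in> (\<Union>P\<in>D. e P)")
      case True
      then obtain X Y where XY: "X \<in> F" "Y \<in> F" "X \<noteq> Y" "tail G a \<in> X" "head G a \<in> Y"
        by (auto simp: D_def e_def)
      hence "linked E X Y" using a cmp unfolding linked_def E_def by auto
      hence "(X, Y) \<in> L" using XY by (simp add: L_def)
      moreover have "a \<in> e (X, Y)" using XY aG by (simp add: e_def)
      ultimately show ?thesis by blast
    qed (use aG in simp)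
  qed
  hence "card (arcs G') \<le> card ((arcs G - (\<Union>P\<in>D. e P)) \<union> (\<Union>P\<in>L. e P))"
    using fA finite_subset[OF eA[of L] fA] by (intro card_mono) auto
  also have "\<dots> \<le> card (arcs G - (\<Union>P\<in>D. e P)) + card (\<Union>P\<in>L. e P)" by (rule card_Un_le)
  also have "card (arcs G - (\<Union>P\<in>D. e P)) = card (arcs G) - card (\<Union>P\<in>D. e P)"
    using finite_subset[OF eA[of D] fA] eA[of D] by (rule card_Diff_subset)
  finally have "card (arcs G') + card (\<Union>P\<in>D. e P) \<le> card (arcs G) + card (\<Union>P\<in>L. e P)"
    using card_mono[OF fA eA[of D]] by linarith
  hence "real (card (arcs G')) + real (\<Sum>P\<in>D. card (e P)) \<le> real (card (arcs G)) + real (\<Sum>P\<in>L. card (e P))"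
    unfolding card_e[OF LD] card_e[OF order.refl] of_nat_add[symmetric] by (rule of_nat_mono)
  moreover have "real (\<Sum>P\<in>L. card (e P)) \<le> real (card L) * (p * (real N)\<^sup>2 + q)"
  proof -
    have "(\<Sum>P\<in>L. real (card (e P))) \<le> (\<Sum>P\<in>L. p * (real N)\<^sup>2 + q)"
      using e LD by (intro sum_mono) (force simp: abs_le_iff)
    thus ?thesis by simp
  qed
  moreover have "real (card F) * (real (card F) - 1) * (p * (real N)\<^sup>2 - q) \<le> real (\<Sum>P\<in>D. card (e P))"
  proof -
    have "(\<Sum>P\<in>D. p * (real N)\<^sup>2 - q) \<le> (\<Sum>P\<in>D. real (card (e P)))"
      using e by (intro sum_mono) (force simp: abs_le_iff)
    thus ?thesis by (simp add: cD)
  qed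
  moreover have "real (card (arcs G)) = p * n\<^sup>2"
    using pr unfolding pseudorandom_def has_edge_density_def n_def by simp
  ultimately have "real (card (arcs G')) \<le> p * n\<^sup>2
      - real (card F) * (real (card F) - 1) * (p * (real N)\<^sup>2 - q) + real (card L) * (p * (real N)\<^sup>2 + q)"
    by linarith
  thus ?thesis unfolding q_def by (simp add: algebra_simps)
qed

text \<open>The entries of \<open>xs\<close> are themselves clusters, so \<open>(!) xs\<close> is
  the family of classes of a blow-up.\<close>

lemma long_cycle_of_cluster_cycle:
  assumes cl: "clusters V N F" and fin: "finite V" and "0 \<le> k" "4 * k + 6 \<le> real N"
    and xs: "cyc R xs" "set xs \<subseteq> F" "2 \<le> length xs"
    and R: "\<And>X Y. R X Y \<Longrightarrow> \<not> hole E k X Y"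
  shows "\<exists>ys. cyc E ys \<and> real (length xs) * (real N - 4 * k - 5) \<le> real (length ys) \<and> 2 \<le> length ys"
proof -
  have F: "xs ! i \<in> F" if "i < length xs" for i using that xs(2) by auto
  interpret blowup E "(!) xs" "length xs" N k
  proof
    show "0 < length xs" using xs(3) by linarith
    show "xs ! i \<inter> xs ! j = {}" if "i < length xs" "j < length xs" "i \<noteq> j" for i j
    proof -
      have "xs ! i \<noteq> xs ! j" using that xs(1) by (simp add: cyc_def nth_eq_iff_index_eq)
      thus ?thesis using cl F[OF that(1)] F[OF that(2)] unfolding clusters_def pairwise_def disjnt_def by auto
    qed
    show "finite (xs ! i)" "card (xs ! i) = N" if "i < length xs" for i
      using cl F[OF that] fin unfolding clusters_def by (auto intro: finite_subset)
    show "\<not> hole E k (xs ! i) (xs ! (Suc i mod length xs))" if "i < length xs" for i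
      using xs that by (intro R) (simp add: cyc_def)
  qed
  show ?thesis using long_cycle[OF xs(3) assms(3,4)] .
qed

text \<open>The arc count after division by \<open>p\<close>. The losses are
  \<open>2 * \<nu>\<close> for the two pseudorandomness errors, \<open>\<kappa>\<close> for the
  diagonal pairs, and \<open>3 * \<theta>\<close> for uncovered vertices, from
  \<open>n\<^sup>2 \<le> (1 + 6 * \<theta>) * K\<^sup>2 * N\<^sup>2\<close> and
  \<open>1/2 - \<gamma> \<le> 1/2\<close>.\<close>

lemma linked_pairs_ge:
  fixes n N K L \<gamma> \<nu> \<theta> \<kappa> :: real
  assumes "(1/2 + \<gamma>) * n\<^sup>2 \<le> n\<^sup>2 - K * (K - 1) * (N\<^sup>2 - t * N) + L * (N\<^sup>2 + t * N)"
    and "0 < \<gamma>" "\<gamma> < 1/2" "0 < N" "1 \<le> K" "1 \<le> \<kappa> * K" "0 \<le> L" "L \<le> K\<^sup>2"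
    and "t \<le> \<nu> * N" "0 \<le> \<nu>" "0 \<le> \<theta>" "\<theta> \<le> 1/4" "(1 - \<theta>) * n \<le> K * N" "0 \<le> n"
  shows "(1/2 + \<gamma> - 2 * \<nu> - \<kappa> - 3 * \<theta>) * K\<^sup>2 \<le> L"
proof -
  have tN: "t * N \<le> \<nu> * N\<^sup>2" using assms by (simp add: power2_eq_square)
  have "L * (N\<^sup>2 + t * N) \<le> L * (N\<^sup>2 + \<nu> * N\<^sup>2)" using tN assms by (intro mult_left_mono) auto
  also have "\<dots> = L * N\<^sup>2 + L * (\<nu> * N\<^sup>2)" by (simp add: algebra_simps)
  also have "\<dots> \<le> L * N\<^sup>2 + K\<^sup>2 * (\<nu> * N\<^sup>2)" using assms by (intro add_left_mono mult_right_mono) auto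
  finally have 1: "L * (N\<^sup>2 + t * N) \<le> L * N\<^sup>2 + K\<^sup>2 * (\<nu> * N\<^sup>2)" .
  have "K * (K - 1) * (N\<^sup>2 - \<nu> * N\<^sup>2) \<le> K * (K - 1) * (N\<^sup>2 - t * N)"
    using tN assms by (intro mult_left_mono) auto
  moreover have "K * (K - 1) * (N\<^sup>2 - \<nu> * N\<^sup>2) = K\<^sup>2 * N\<^sup>2 - K * N\<^sup>2 - K\<^sup>2 * (\<nu> * N\<^sup>2) + K * (\<nu> * N\<^sup>2)"
    by (simp add: algebra_simps power2_eq_square)
  moreover have "0 \<le> K * (\<nu> * N\<^sup>2)" using assms by simp
  moreover have "(1 * K) * N\<^sup>2 \<le> ((\<kappa> * K) * K) * N\<^sup>2" using assms by (intro mult_right_mono) auto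
  hence "K * N\<^sup>2 \<le> \<kappa> * (K\<^sup>2 * N\<^sup>2)" by (simp add: power2_eq_square algebra_simps)
  ultimately have 2: "K\<^sup>2 * N\<^sup>2 - \<kappa> * (K\<^sup>2 * N\<^sup>2) - K\<^sup>2 * (\<nu> * N\<^sup>2) \<le> K * (K - 1) * (N\<^sup>2 - t * N)"
    by linarith
  have "((1 - \<theta>) * n)\<^sup>2 \<le> (K * N)\<^sup>2" using assms by (intro power_mono) auto
  hence 3: "(1 - \<theta>)\<^sup>2 * n\<^sup>2 \<le> K\<^sup>2 * N\<^sup>2" by (simp add: power_mult_distrib)
  \<comment> \<open>The product is \<open>(1 + 6 * \<theta>) * (1 - \<theta>)\<^sup>2 - 1\<close>
    expanded.\<close>
  have "0 \<le> \<theta> * (4 - 11 * \<theta> + 6 * \<theta>\<^sup>2)" using assms by (intro mult_nonneg_nonneg add_nonneg_nonneg) auto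
  hence "1 \<le> (1 + 6 * \<theta>) * (1 - \<theta>)\<^sup>2" by (simp add: power2_eq_square algebra_simps)
  hence "1 * n\<^sup>2 \<le> ((1 + 6 * \<theta>) * (1 - \<theta>)\<^sup>2) * n\<^sup>2" by (intro mult_right_mono) auto
  also have "\<dots> = (1 + 6 * \<theta>) * ((1 - \<theta>)\<^sup>2 * n\<^sup>2)" by simp
  also have "\<dots> \<le> (1 + 6 * \<theta>) * (K\<^sup>2 * N\<^sup>2)" using 3 assms by (intro mult_left_mono) auto
  finally have "(1/2 - \<gamma>) * n\<^sup>2 \<le> (1/2 - \<gamma>) * ((1 + 6 * \<theta>) * (K\<^sup>2 * N\<^sup>2))"
    using assms by (intro mult_left_mono) auto
  moreover have "(1/2 - \<gamma>) * ((1 + 6 * \<theta>) * (K\<^sup>2 * N\<^sup>2)) = (1/2 - \<gamma>) * (K\<^sup>2 * N\<^sup>2) + (3 * \<theta> - 6 * (\<gamma> * \<theta>)) * (K\<^sup>2 * N\<^sup>2)"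
    by (simp add: algebra_simps)
  moreover have "(3 * \<theta> - 6 * (\<gamma> * \<theta>)) * (K\<^sup>2 * N\<^sup>2) \<le> 3 * \<theta> * (K\<^sup>2 * N\<^sup>2)"
    using assms by (intro mult_right_mono) auto
  ultimately have 4: "(1/2 - \<gamma>) * n\<^sup>2 \<le> (1/2 - \<gamma>) * (K\<^sup>2 * N\<^sup>2) + 3 * \<theta> * (K\<^sup>2 * N\<^sup>2)" by linarith
  have "(1/2 - \<gamma>) * n\<^sup>2 = n\<^sup>2 - (1/2 + \<gamma>) * n\<^sup>2" by (simp add: algebra_simps)
  hence "K\<^sup>2 * N\<^sup>2 - \<kappa> * (K\<^sup>2 * N\<^sup>2) - 2 * (K\<^sup>2 * (\<nu> * N\<^sup>2)) - (1/2 - \<gamma>) * (K\<^sup>2 * N\<^sup>2) - 3 * \<theta> * (K\<^sup>2 * N\<^sup>2) \<le> L * N\<^sup>2"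
    using assms(1) 1 2 4 by linarith
  hence "((1/2 + \<gamma> - 2 * \<nu> - \<kappa> - 3 * \<theta>) * K\<^sup>2) * N\<^sup>2 \<le> L * N\<^sup>2"
    by (simp add: algebra_simps)
  thus ?thesis using assms by simp
qed

section \<open>Choice of constants and conclusion\<close>

theorem theorem4:
  fixes \<gamma> \<alpha> \<epsilon> :: real
  assumes "0 < \<gamma>" and "\<gamma> < 1/2"
    and "0 \<le> \<alpha>" and "\<alpha> < 1"
    and "2 * \<gamma> = 1 - (1 - w \<alpha>) * (\<alpha> + w \<alpha>)"
    and "0 < \<epsilon>"
  shows "\<exists>\<mu>>0. \<exists>C>0. \<exists>n\<^sub>0::nat.
    \<forall>(G :: ('a, 'b) pre_digraph) (G' :: ('a, 'b) pre_digraph) (n::nat) (p::real) (r::real).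
      digraph G \<and> card (verts G) = n \<and> n \<ge> n\<^sub>0 \<and>
      p \<ge> C / real n \<and> r \<le> \<mu> * sqrt (real n * p) \<and>
      pseudorandom G p r \<and>
      subgraph G' G \<and>
      real (card (arcs G')) \<ge> (1/2 + \<gamma>) * real (card (arcs G)) \<longrightarrow>
      (\<exists>c. pre_digraph.cycle G' c \<and> real (length c) \<ge> (1 - \<alpha> - \<epsilon>) * real n)"
proof -
  have ps: "packed_squares 1 (1 - \<alpha>) = 2 * \<gamma>"
    unfolding assms(5) w_def packed_squares_def
    by (simp add: inverse_eq_divide power2_eq_square algebra_simps)
  have "0 < 1 - \<alpha>" "1 - \<alpha> \<le> 1" "0 < \<epsilon> / 4" using assms by auto
  then obtain l where l: "0 < l" "1 - \<alpha> - \<epsilon> / 4 < l" "l < 1 - \<alpha>" "packed_squares 1 l < 2 * \<gamma>"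
    unfolding ps[symmetric] by (rule packed_squares_less)
  \<comment> \<open>Half of the gap: \<open>edges_le_packed_squares\<close> at length
    \<open>l\<close> then gives density at most \<open>1/2 + \<gamma> - \<delta>\<close>.\<close>
  define \<delta> where "\<delta> = (2 * \<gamma> - packed_squares 1 l) / 2"
  have \<delta>: "0 < \<delta>" "packed_squares 1 l = 2 * \<gamma> - 2 * \<delta>" using l(4) by (simp_all add: \<delta>_def field_simps)
  \<comment> \<open>The density budget in units of \<open>\<delta> / 10\<close>: two for
    pseudorandomness, one for the diagonal, three for uncovered vertices and one for holes, seven in
    total. The length budget has four shares of \<open>\<epsilon> / 4\<close>: for \<open>l\<close>,
    \<open>\<theta>\<close>, \<open>\<eta>\<close> and rounding.\<close>
  define \<theta> where "\<theta> = min (1/4) (min (\<epsilon> / 4) (\<delta> / 10))"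
  have \<theta>: "0 < \<theta>" "\<theta> \<le> 1/4" "\<theta> \<le> \<epsilon> / 4" "\<theta> \<le> \<delta> / 10" using assms \<delta> by (auto simp: \<theta>_def)
  define \<eta> where "\<eta> = min (1/16) (\<epsilon> / 16)"
  have \<eta>: "0 < \<eta>" "\<eta> \<le> 1/16" "\<eta> \<le> \<epsilon> / 16" using assms by (auto simp: \<eta>_def)
  \<comment> \<open>As \<open>K \<ge> K\<^sub>0 / 2\<close>, the first term makes the diagonal
    negligible and the second gives \<open>l * K \<ge> 2\<close>, so that the cycle of clusters is
    not a single vertex.\<close>
  define K\<^sub>0 where "K\<^sub>0 = nat \<lceil>20 / \<delta>\<rceil> + nat \<lceil>4 / l\<rceil> + 1"
  have K\<^sub>0: "20 / \<delta> \<le> real K\<^sub>0" "4 / l \<le> real K\<^sub>0" "0 < K\<^sub>0" unfolding K\<^sub>0_def by linarith+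
  have "0 < \<delta> / 10" "\<theta> \<le> 1/2" using \<delta> \<theta> by auto
  then obtain M n\<^sub>1 where M: "0 < M" and reg: "\<And>(V :: 'a set) E. finite V \<Longrightarrow> n\<^sub>1 \<le> card V \<Longrightarrow>
    \<exists>N F. balanced V K\<^sub>0 M \<theta> N F \<and> real (card (holes E \<eta> N F)) \<le> \<delta> / 10 * (real (card F))\<^sup>2"
    using clusters_without_holes[OF \<eta>(1) _ K\<^sub>0(3) \<theta>(1), where 'a = 'a] by metis
  \<comment> \<open>Clusters have at least \<open>n / M\<close> vertices, so
    \<open>\<mu> * n \<le> \<delta> / 10 * N\<close>.\<close>
  define \<mu> where "\<mu> = \<delta> / (10 * real M)"
  have \<mu>: "0 < \<mu>" using \<delta> M by (simp add: \<mu>_def)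
  \<comment> \<open>\<open>8 * M\<close> gives \<open>N \<ge> 8\<close>, which with
    \<open>\<eta> \<le> 1/16\<close> meets the size condition of \<open>long_cycle\<close>; the last
    term makes the additive loss of 5 per cluster at most \<open>\<epsilon> / 4 * n\<close>.\<close>
  define n\<^sub>0 where "n\<^sub>0 = n\<^sub>1 + 8 * M + nat \<lceil>20 * real M / \<epsilon>\<rceil>"
  show ?thesis
  \<comment> \<open>\<open>C = 1\<close> makes \<open>p\<close> positive, so that the count of arcs
    can be divided by \<open>p\<close>.\<close>
  proof (rule exI[of _ \<mu>], rule conjI[OF \<mu>], rule exI[of _ 1], rule conjI[OF zero_less_one],
      rule exI[of _ n\<^sub>0], intro allI impI, elim conjE)
    fix G G' :: "('a, 'b) pre_digraph" and n :: nat and p r :: real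
    assume dg: "digraph G" and n: "card (verts G) = n" and n0: "n\<^sub>0 \<le> n" and p: "1 / real n \<le> p"
      and r: "r \<le> \<mu> * sqrt (real n * p)" and pr: "pseudorandom G p r" and sub: "subgraph G' G"
      and arcs: "(1/2 + \<gamma>) * real (card (arcs G)) \<le> real (card (arcs G'))"
    have n_ge: "n\<^sub>1 \<le> n" "8 * M \<le> n" "20 * real M / \<epsilon> \<le> real n" using n0 unfolding n\<^sub>0_def by linarith+
    hence n_pos: "0 < n" using M by linarith
    hence p_pos: "0 < p" using p by (smt (verit) divide_pos_pos of_nat_0_less_iff)
    interpret G: digraph G by (rule dg)
    interpret G': wf_digraph G' using sub by (simp add: subgraph_def)
    define E where "E = (\<lambda>x y. \<exists>a\<in>arcs G'. tail G' a = x \<and> head G' a = y)"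
    obtain N F where "balanced (verts G) K\<^sub>0 M \<theta> N F"
      and hol: "real (card (holes E \<eta> N F)) \<le> \<delta> / 10 * (real (card F))\<^sup>2"
      using reg[of "verts G" E] n n_ge(1) by auto
    hence cl: "clusters (verts G) N F" and NK: "N * K\<^sub>0 \<le> n" and nM: "n \<le> M * N"
      and cov: "(1 - \<theta>) * real n \<le> real (card (\<Union>F))"
      unfolding balanced_def n by auto
    define K where "K = card F"
    have fF: "finite F" using cl by (rule clusters_finite) simp
    have UF: "card (\<Union>F) = K * N" unfolding K_def by (rule card_Union_clusters[OF cl]) simp
    have cov': "(1 - \<theta>) * real n \<le> real K * real N" using cov UF by simp
    have "M * 8 \<le> M * N" using n_ge(2) nM by linarith
    hence N8: "8 \<le> N" using M by simp
    have "K * N \<le> n" using UF card_mono[OF _ clusters_Union[OF cl]] n by simp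
    hence "K * N \<le> M * N" using nM by linarith
    hence KM: "K \<le> M" using N8 by simp
    have KK\<^sub>0: "1/2 * real K\<^sub>0 \<le> real K"
    proof -
      have "real N * real K\<^sub>0 \<le> real n" using NK by (metis of_nat_le_iff of_nat_mult)
      hence "(1 - \<theta>) * (real N * real K\<^sub>0) \<le> (1 - \<theta>) * real n" using \<theta> by (intro mult_left_mono) auto
      hence "((1 - \<theta>) * real K\<^sub>0) * real N \<le> real K * real N" using cov' by (simp add: algebra_simps)
      hence "(1 - \<theta>) * real K\<^sub>0 \<le> real K" using N8 by simp
      moreover have "1/2 * real K\<^sub>0 \<le> (1 - \<theta>) * real K\<^sub>0" using \<theta> by (intro mult_right_mono) auto
      ultimately show ?thesis by linarith
    qed
    hence "10 / \<delta> \<le> real K" "2 / l \<le> real K" using K\<^sub>0(1,2) by linarith+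
    hence K: "1 \<le> \<delta> / 10 * real K" "2 \<le> l * real K" using \<delta>(1) l(1) by (simp_all add: field_simps)
    have K1: "0 < K" using K(2) by (cases "K = 0") auto
    have nMN: "real n \<le> real M * real N" using nM by (metis of_nat_le_iff of_nat_mult)
    \<comment> \<open>The reduced digraph on the clusters: linked pairs without a hole.\<close>
    define R where "R = (\<lambda>X Y. X \<noteq> Y \<and> linked E X Y \<and> \<not> hole E (\<eta> * real N) X Y)"
    define L where "L = {(X, Y). X \<in> F \<and> Y \<in> F \<and> X \<noteq> Y \<and> linked E X Y}"
    have LF: "L \<subseteq> F \<times> F" by (auto simp: L_def)
    hence fL: "finite L" using fF by (auto intro: finite_subset)
    have "card L \<le> K * K"
      using card_mono[OF _ LF] fF by (simp add: card_cartesian_product K_def)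
    hence LK: "real (card L) \<le> (real K)\<^sup>2"
      unfolding power2_eq_square by (metis of_nat_mono of_nat_mult)
    have "p * ((1/2 + \<gamma>) * (real n)\<^sup>2) \<le> real (card (arcs G'))"
      using arcs pr n unfolding pseudorandom_def has_edge_density_def by (simp add: mult.left_commute)
    also have "\<dots> \<le> p * ((real n)\<^sup>2 - real K * (real K - 1) * ((real N)\<^sup>2 - \<mu> * real n * real N)
        + real (card L) * ((real N)\<^sup>2 + \<mu> * real n * real N))"
      using arcs_le_linked_pairs[OF dg sub pr less_imp_le[OF p_pos] _ cl, of \<mu>] r
      unfolding n K_def L_def E_def by simp
    finally have cnt: "(1/2 + \<gamma>) * (real n)\<^sup>2 \<le> (real n)\<^sup>2
        - real K * (real K - 1) * ((real N)\<^sup>2 - \<mu> * real n * real N)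
        + real (card L) * ((real N)\<^sup>2 + \<mu> * real n * real N)"
      using p_pos by simp
    have "\<mu> * real n \<le> \<mu> * (real M * real N)" using nMN \<mu> by (intro mult_left_mono) auto
    also have "\<dots> = \<delta> / 10 * real N" using M by (simp add: \<mu>_def)
    finally have t: "\<mu> * real n \<le> \<delta> / 10 * real N" .
    have "(1/2 + \<gamma> - 2 * (\<delta> / 10) - \<delta> / 10 - 3 * \<theta>) * (real K)\<^sup>2 \<le> real (card L)"
      by (rule linked_pairs_ge[OF cnt assms(1,2) _ _ K(1) _ LK t]) (use N8 K1 \<delta> \<theta> cov' in auto)
    moreover have "(1/2 + \<gamma> - 6 * (\<delta> / 10)) * (real K)\<^sup>2 \<le> (1/2 + \<gamma> - 2 * (\<delta> / 10) - \<delta> / 10 - 3 * \<theta>) * (real K)\<^sup>2"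
      using \<theta> by (intro mult_right_mono) auto
    ultimately have L: "(1/2 + \<gamma> - 6 * (\<delta> / 10)) * (real K)\<^sup>2 \<le> real (card L)" by linarith
    define ER where "ER = {(X, Y). X \<in> F \<and> Y \<in> F \<and> R X Y}"
    have "ER \<subseteq> F \<times> F" "holes E \<eta> N F \<subseteq> F \<times> F" by (auto simp: ER_def holes_def)
    hence fin: "finite ER" "finite (holes E \<eta> N F)" using fF by (auto intro: finite_subset)
    have "L \<subseteq> ER \<union> holes E \<eta> N F" by (auto simp: L_def ER_def R_def holes_def)
    hence "card L \<le> card (ER \<union> holes E \<eta> N F)" using fin by (intro card_mono) auto
    also have "\<dots> \<le> card ER + card (holes E \<eta> N F)" by (rule card_Un_le)
    finally have "real (card L) \<le> real (card ER) + real (card (holes E \<eta> N F))"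
      by (metis of_nat_add of_nat_mono)
    hence "(1/2 + \<gamma> - 6 * (\<delta> / 10)) * (real K)\<^sup>2 - \<delta> / 10 * (real K)\<^sup>2 \<le> real (card ER)"
      using L hol unfolding K_def[symmetric] by linarith
    moreover have "(1/2 + \<gamma> - \<delta>) * (real K)\<^sup>2 < (1/2 + \<gamma> - 6 * (\<delta> / 10) - \<delta> / 10) * (real K)\<^sup>2"
      using \<delta>(1) K1 by (intro mult_strict_right_mono) auto
    ultimately have ER: "(1/2 + \<gamma> - \<delta>) * (real K)\<^sup>2 < real (card ER)" by (simp add: left_diff_distrib)
    \<comment> \<open>Otherwise the extremal bound, scaled from 1 to \<open>K\<close>, contradicts
      the density of \<open>R\<close>.\<close>
    have "\<exists>xs. cyc R xs \<and> set xs \<subseteq> F \<and> l * real K < real (length xs)"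
    proof (rule ccontr)
      assume "\<not> ?thesis"
      hence "\<And>xs. cyc R xs \<Longrightarrow> set xs \<subseteq> F \<Longrightarrow> real (length xs) \<le> l * real K" by (meson not_le)
      from edges_le_packed_squares[OF fF _ this]
      have "real (card ER) \<le> ((real K)\<^sup>2 + packed_squares (real K) (l * real K)) / 2"
        using l K1 unfolding ER_def K_def by simp
      also have "packed_squares (real K) (l * real K) = (real K)\<^sup>2 * packed_squares 1 l"
        using packed_squares_scale[of "real K" 1 l] K1 by (simp add: mult.commute)
      finally have "real (card ER) \<le> (1/2 + \<gamma> - \<delta>) * (real K)\<^sup>2"
        unfolding \<delta>(2) by (simp add: algebra_simps)
      thus False using ER by linarith
    qed
    then obtain xs where xs: "cyc R xs" "set xs \<subseteq> F" "l * real K < real (length xs)" by blast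
    have "2 \<le> length xs" using xs(3) K(2) by linarith
    moreover have "\<eta> * real N \<le> 1/16 * real N" using \<eta> by (intro mult_right_mono) auto
    hence big: "4 * (\<eta> * real N) + 6 \<le> real N" using N8 by linarith
    moreover have "\<not> hole E (\<eta> * real N) X Y" if "R X Y" for X Y using that by (simp add: R_def)
    ultimately obtain ys where ys: "cyc E ys" "2 \<le> length ys"
      and len: "real (length xs) * (real N - 4 * (\<eta> * real N) - 5) \<le> real (length ys)"
      using long_cycle_of_cluster_cycle[OF cl _ _ _ xs(1,2), of "\<eta> * real N" E] \<eta>(1) by auto
    obtain c where c: "G'.cycle c" "length c = length ys"
      using G'.cycle_of_cyc[OF ys(1)[unfolded E_def] ys(2)] by blast
    have "(1 - \<alpha> - \<epsilon>) * real n \<le> real (length ys)"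
    proof -
      have l1: "l \<le> 1" using l(3) assms(3) by simp
      have "(l - \<epsilon> / 4 - \<epsilon> / 4) * real n \<le> (l * (1 - 4 * \<eta>) * (1 - \<theta>)) * real n"
      proof (rule mult_right_mono)
        have "l * \<theta> \<le> 1 * \<theta>" "l * \<eta> \<le> 1 * \<eta>" using l1 \<theta> \<eta> by (intro mult_right_mono; simp)+
        moreover have "0 \<le> l * \<eta> * \<theta>" using l(1) \<theta> \<eta> by simp
        moreover have "l * (1 - 4 * \<eta>) * (1 - \<theta>) = l - l * \<theta> - 4 * (l * \<eta>) + 4 * (l * \<eta> * \<theta>)"
          by (simp add: algebra_simps)
        ultimately show "l - \<epsilon> / 4 - \<epsilon> / 4 \<le> l * (1 - 4 * \<eta>) * (1 - \<theta>)"
          using \<theta>(3) \<eta>(3) by linarith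
      qed simp
      also have "\<dots> = l * (1 - 4 * \<eta>) * ((1 - \<theta>) * real n)" by simp
      also have "\<dots> \<le> l * (1 - 4 * \<eta>) * (real K * real N)"
        using cov' l(1) \<eta> by (intro mult_left_mono) auto
      finally have 1: "(l - \<epsilon> / 4 - \<epsilon> / 4) * real n \<le> l * (1 - 4 * \<eta>) * (real K * real N)" .
      have "l * real K \<le> 1 * real M" using l1 l(1) KM by (intro mult_mono) auto
      moreover have "20 * real M \<le> \<epsilon> * real n" using n_ge(3) assms(6) by (simp add: field_simps)
      ultimately have 2: "5 * (l * real K) \<le> \<epsilon> / 4 * real n" by linarith
      have "(l * real K) * (real N - 4 * (\<eta> * real N) - 5)
          \<le> real (length xs) * (real N - 4 * (\<eta> * real N) - 5)"
        using xs(3) big by (intro mult_right_mono) auto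
      moreover have "(l * real K) * (real N - 4 * (\<eta> * real N) - 5)
          = l * (1 - 4 * \<eta>) * (real K * real N) - 5 * (l * real K)"
        by (simp add: algebra_simps)
      moreover have "(1 - \<alpha> - \<epsilon>) * real n \<le> (l - \<epsilon> / 4 - \<epsilon> / 4 - \<epsilon> / 4) * real n"
        using l(2) by (intro mult_right_mono) auto
      moreover have "(l - \<epsilon> / 4 - \<epsilon> / 4 - \<epsilon> / 4) * real n = (l - \<epsilon> / 4 - \<epsilon> / 4) * real n - \<epsilon> / 4 * real n"
        by (simp only: left_diff_distrib)
      ultimately show ?thesis using 1 2 len by linarith
    qed
    thus "\<exists>c. G'.cycle c \<and> (1 - \<alpha> - \<epsilon>) * real n \<le> real (length c)" using c by auto
  qed
qed

end
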